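(* As $p\to\infty$ over the integers, $N(p,2,2)=\Omega(p\log p)$ and $N(p,2,2)=O\bigl((p\log\log p)^2\bigr)$. That is, there exist absolute constants $c,C>0$ and an integer $p_0$ such that for all integers $p\ge p_0$, $$c\,p\log p\;\le\; N(p,2,2)\;\le\; C\,(p\log\log p)^2 .$$
   Context: An axis-parallel box in $\mathbb{R}^d$ is a Cartesian product of $d$ closed intervals in $\mathbb{R}$. For a set $X$ and a family $\mathcal{F}$ of sets, the trace of $\mathcal{F}$ on $X$ is $\mathcal{F}|_X=\{F\cap X: F\in\mathcal{F}\}$. For integers $p\ge q$, a family $\mathcal{F}$ has the $(p,q)$-property if among every $p$ members of $\mathcal{F}$ there are $q$ members that intersect (i.e. have a common point). The piercing number $\tau(\mathcal{F})$ is the smallest size of a set $S$ that intersects every member of $\mathcal{F}$. $N(p,q,d)$ denotes the minimal universal upper bound on $\tau(\mathcal{B}|_P)$ over all sets $P\subseteq\mathbb{R}^d$ and all finite families $\mathcal{B}$ of axis-parallel boxes in $\mathbb{R}^d$ such that $\mathcal{B}|_P$ has the $(p,q)$-property and does not contain the empty set. *)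

theory Defs
  imports "HOL-Analysis.Analysis" "HOL-Library.Extended_Nat" "HOL-Library.Extended_Real"
begin

definition axis_parallel_box :: "(real ^ 'd::finite) set \<Rightarrow> bool" where
  "axis_parallel_box B \<longleftrightarrow> (\<exists>a b. (\<forall>i. a $ i \<le> b $ i) \<and> B = cbox a b)"

definition trace_on :: "'a set set \<Rightarrow> 'a set \<Rightarrow> 'a set set" where
  "trace_on \<F> X = {F \<inter> X |F. F \<in> \<F>}"

definition pq_property :: "nat \<Rightarrow> nat \<Rightarrow> 'a set set \<Rightarrow> bool" where
  "pq_property p q \<F> \<longleftrightarrow>
     (\<forall>\<G>. \<G> \<subseteq> \<F> \<and> finite \<G> \<and> card \<G> = p \<longrightarrow>
        (\<exists>\<H>. \<H> \<subseteq> \<G> \<and> card \<H> = q \<and> \<Inter>\<H> \<noteq> {}))"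

text \<open>The value is \<open>\<infinity>\<close> exactly when no finite set meets every member of the family.\<close>

definition piercing_number :: "'a set set \<Rightarrow> enat" where
  "piercing_number \<F> = Inf {enat (card S) |S. finite S \<and> (\<forall>F\<in>\<F>. S \<inter> F \<noteq> {})}"

text \<open>
  The dimension \<open>d\<close> is the cardinality of the index type \<open>'d\<close>. Minimal upper bounds are
  taken in \<open>enat\<close>, so the value is \<open>\<infinity>\<close> if the piercing numbers are unbounded.
\<close>

definition N :: "nat \<Rightarrow> nat \<Rightarrow> 'd::finite itself \<Rightarrow> enat" where
  "N p q (_ :: 'd itself) =
     Sup {piercing_number (trace_on \<B> P) |(\<B> :: (real ^ 'd) set set) (P :: (real ^ 'd) set).
            finite \<B> \<and> (\<forall>B\<in>\<B>. axis_parallel_box B) \<and>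
            pq_property p q (trace_on \<B> P) \<and> {} \<notin> trace_on \<B> P}"

end

theory Submission
  imports Defs
begin

text \<open>
  Upper bound, in the stronger form \<open>O(p\<^sup>2)\<close>. For boxes with a common point \<open>\<omega>\<close>, the trace in each of the
  four quadrants at \<open>\<omega>\<close> behaves like an interval on the staircase of minimal points of \<open>P\<close>. If every
  point had small weight, a weighted count of intersecting pairs (of two intersecting intervals, one
  contains the left end of the other) would give a large packing; so under each weighting of the boxes
  some point is heavy, multiplicative weights turn this into a fractional cover, and on intervals a
  fractional cover can be rounded. Two rounds of halving, with a vertical and a horizontal line, reduce
  the general case to boxes with a common point.

  Lower bound. Over the alphabet \<open>{0, 1, 2}\<close>, take the rectangles that fix the digits of \<open>X\<close> up to a level
  \<open>i\<close> and the digits of \<open>Y\<close> from level \<open>i\<close> on, both with digit 2 at level \<open>i\<close>. A point \<open>(X, Y)\<close> lies in one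
  rectangle for each level where both digits are 2; only points with at most two such levels are kept,
  so piercing needs half as many points as there are rectangles, namely \<open>k * 3 ^ (k - 1) / 2\<close>. A
  second moment argument shows that a packing has at most \<open>3 ^ (k + 1)\<close> members.
\<close>

section \<open>Packings and piercing sets\<close>

text \<open>Members stay full sets, so that boxes keep their geometry; only disjointness is tested
  inside \<open>P\<close>.\<close>

definition packing_le :: "'a set \<Rightarrow> 'a set set \<Rightarrow> nat \<Rightarrow> bool" where
  "packing_le P \<F> n \<longleftrightarrow> (\<forall>\<G>\<subseteq>\<F>. disjoint_family_on (\<lambda>B. B \<inter> P) \<G> \<longrightarrow> card \<G> \<le> n)"

definition pierceable :: "'a set \<Rightarrow> 'a set set \<Rightarrow> nat \<Rightarrow> bool" where
  "pierceable P \<F> m \<longleftrightarrow> (\<exists>S\<subseteq>P. finite S \<and> card S \<le> m \<and> (\<forall>B\<in>\<F>. S \<inter> B \<noteq> {}))"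

lemma packing_le_subset: "packing_le P \<F> n \<Longrightarrow> \<G> \<subseteq> \<F> \<Longrightarrow> packing_le P \<G> n"
  unfolding packing_le_def by blast

lemma packing_le_0: "packing_le P \<F> 0 \<Longrightarrow> finite \<F> \<Longrightarrow> \<F> = {}"
proof (rule ccontr)
  assume "packing_le P \<F> 0" "\<F> \<noteq> {}"
  then obtain B where "B \<in> \<F>" by blast
  then have "card {B} \<le> 0"
    using \<open>packing_le P \<F> 0\<close> unfolding packing_le_def
    by (metis disjoint_family_on_def empty_subsetI insert_subset singletonD)
  then show False by simp
qed

lemma pierceable_empty: "pierceable P {} m"
  unfolding pierceable_def by (intro exI[of _ "{}"]) simp

lemma pierceable_mono: "pierceable P \<F> m \<Longrightarrow> m \<le> m' \<Longrightarrow> \<F>' \<subseteq> \<F> \<Longrightarrow> pierceable P \<F>' m'"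
  unfolding pierceable_def by (meson le_trans subset_iff)

lemma pierceable_Un:
  assumes "pierceable P \<F> m" "pierceable P \<G> l"
  shows "pierceable P (\<F> \<union> \<G>) (m + l)"
proof -
  obtain S T where S: "S \<subseteq> P" "finite S" "card S \<le> m" "\<forall>B\<in>\<F>. S \<inter> B \<noteq> {}"
    and T: "T \<subseteq> P" "finite T" "card T \<le> l" "\<forall>B\<in>\<G>. T \<inter> B \<noteq> {}"
    using assms unfolding pierceable_def by blast
  have "card (S \<union> T) \<le> m + l"
    using card_Un_le[of S T] S(3) T(3) by linarith
  moreover have "\<forall>B\<in>\<F> \<union> \<G>. (S \<union> T) \<inter> B \<noteq> {}" using S(4) T(4) by blast
  ultimately show ?thesis unfolding pierceable_def using S T by (intro exI[of _ "S \<union> T"]) simp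
qed

text \<open>Divide and conquer along \<open>\<pi>\<close>: a cut \<open>c\<close> leaves packings of
  size at most \<open>n div 2\<close> strictly on either side, and \<open>crossing\<close> handles
  the members whose range contains \<open>c\<close>. The costs
  \<open>2 * f (n div 2) + K * n\<^sup>2\<close> stay below
  \<open>f n = 2 * K * n\<^sup>2\<close>.\<close>

lemma pierceable_by_halving:
  fixes lo hi :: "'a set \<Rightarrow> real" and \<pi> :: "'a \<Rightarrow> real" and K :: nat
  assumes "finite \<F>" "{} \<notin> \<F>"
    and proj: "\<And>B z. B \<in> \<F> \<Longrightarrow> z \<in> B \<Longrightarrow> lo B \<le> \<pi> z \<and> \<pi> z \<le> hi B"
    and crossing: "\<And>\<G> c n. \<G> \<subseteq> \<F> \<Longrightarrow> \<forall>B\<in>\<G>. lo B \<le> c \<and> c \<le> hi B \<Longrightarrow>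
      packing_le P \<G> n \<Longrightarrow> pierceable P \<G> (K * n\<^sup>2)"
    and "packing_le P \<F> n"
  shows "pierceable P \<F> (2 * K * n\<^sup>2)"
proof -
  have "pierceable P \<G> (2 * K * n\<^sup>2)" if "\<G> \<subseteq> \<F>" "packing_le P \<G> n" for \<G> n
    using that
  proof (induction n arbitrary: \<G> rule: less_induct)
    case (less n)
    have fin: "finite \<G>" using less.prems(1) \<open>finite \<F>\<close> finite_subset by blast
    show ?case
    proof (cases "n = 0")
      case True
      then show ?thesis using less.prems(2) fin packing_le_0 pierceable_empty by metis
    next
      case n: False
      define h where "h = n div 2"
      have "h < n" using n by (simp add: h_def)
      show ?thesis
      proof (cases "packing_le P \<G> h")
        case True
        then have "pierceable P \<G> (2 * K * h\<^sup>2)" using less.IH[OF \<open>h < n\<close> less.prems(1)] by blast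
        moreover have "2 * K * h\<^sup>2 \<le> 2 * K * n\<^sup>2" using \<open>h < n\<close> by (intro mult_left_mono power_mono) auto
        ultimately show ?thesis by (rule pierceable_mono) auto
      next
        case False
        then have ne: "\<G> \<noteq> {}" by (auto simp: packing_le_def)
        \<comment> \<open>The cut will be the first right end \<open>c\<close> such that the members
          ending by \<open>c\<close> contain a packing of more than \<open>h\<close>.\<close>
        define C where "C = {c \<in> hi ` \<G>. \<not> packing_le P {B \<in> \<G>. hi B \<le> c} h}"
        have "{B \<in> \<G>. hi B \<le> Max (hi ` \<G>)} = \<G>" using fin by auto
        then have "Max (hi ` \<G>) \<in> C" using fin ne False by (simp add: C_def)
        moreover have finC: "finite C" using fin by (simp add: C_def)
        ultimately have c: "Min C \<in> C" using Min_in by blast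
        define c where "c = Min C"
        have c_in: "\<not> packing_le P {B \<in> \<G>. hi B \<le> c} h" using c by (simp add: C_def c_def)
        then obtain A where A: "A \<subseteq> {B \<in> \<G>. hi B \<le> c}" "disjoint_family_on (\<lambda>B. B \<inter> P) A" "card A > h"
          unfolding packing_le_def by (metis linorder_not_le)
        let ?L = "{B \<in> \<G>. hi B < c}" and ?R = "{B \<in> \<G>. c < lo B}"
          and ?M = "{B \<in> \<G>. lo B \<le> c \<and> c \<le> hi B}"
        have "packing_le P ?L h"
        proof (cases "?L = {}")
          case True then show ?thesis unfolding True by (simp add: packing_le_def)
        next
          case False
          \<comment> \<open>Minimality of \<open>c\<close> is applied to the last right end before
            it.\<close>
          define c' where "c' = Max (hi ` ?L)"
          have c'_in: "c' \<in> hi ` ?L" unfolding c'_def using fin False by (intro Max_in) auto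
          then have "c' < c" by auto
          then have "c' \<notin> C" using finC c_def Min_le linorder_not_less by metis
          moreover have "c' \<in> hi ` \<G>" using c'_in by auto
          ultimately have "packing_le P {B \<in> \<G>. hi B \<le> c'} h" by (simp add: C_def)
          moreover have "?L \<subseteq> {B \<in> \<G>. hi B \<le> c'}" unfolding c'_def using fin by auto
          ultimately show ?thesis by (rule packing_le_subset)
        qed
        moreover have "?L \<subseteq> \<F>" using less.prems(1) by blast
        ultimately have L: "pierceable P ?L (2 * K * h\<^sup>2)" using less.IH[OF \<open>h < n\<close>] by simp
        \<comment> \<open>A packing on the right extends \<open>A\<close>; together they have at
          most \<open>n\<close> members, of which \<open>A\<close> has at least
          \<open>h + 1\<close>.\<close>
        have "packing_le P ?R h"
          unfolding packing_le_def
        proof (intro allI impI)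
          fix D assume D: "D \<subseteq> ?R" "disjoint_family_on (\<lambda>B. B \<inter> P) D"
          have sep: "B \<inter> B' = {}" if "B \<in> A" "B' \<in> D" for B B'
          proof -
            have "hi B \<le> c" "c < lo B'" "B \<in> \<F>" "B' \<in> \<F>" using that A(1) D(1) less.prems(1) by auto
            then show ?thesis using proj[of B] proj[of B'] by fastforce
          qed
          \<comment> \<open>A common member would be separated from itself, hence empty.\<close>
          have "B \<notin> D" if "B \<in> A" for B
            using sep[of B B] that A(1) less.prems(1) \<open>{} \<notin> \<F>\<close> by (auto simp: subset_iff)
          then have "A \<inter> D = {}" by blast
          have "disjoint_family_on (\<lambda>B. B \<inter> P) (A \<union> D)"
            using A(2) D(2) sep unfolding disjoint_family_on_def by blast
          then have "card (A \<union> D) \<le> n" using less.prems(2) A(1) D(1) unfolding packing_le_def by blast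
          moreover have "card (A \<union> D) = card A + card D"
            using \<open>A \<inter> D = {}\<close> A(1) D(1) fin by (intro card_Un_disjoint) (auto intro: finite_subset)
          ultimately show "card D \<le> h" using A(3) by (simp add: h_def)
        qed
        moreover have "?R \<subseteq> \<F>" using less.prems(1) by blast
        ultimately have R: "pierceable P ?R (2 * K * h\<^sup>2)" using less.IH[OF \<open>h < n\<close>] by simp
        have M: "pierceable P ?M (K * n\<^sup>2)"
        proof (rule crossing[where c = c])
          show "?M \<subseteq> \<F>" using less.prems(1) by blast
          show "packing_le P ?M n" by (rule packing_le_subset[OF less.prems(2)]) blast
        qed simp
        have eq: "(?L \<union> ?R) \<union> ?M = \<G>" by auto
        have "pierceable P \<G> ((2 * K * h\<^sup>2 + 2 * K * h\<^sup>2) + K * n\<^sup>2)"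
          using pierceable_Un[OF pierceable_Un[OF L R] M] unfolding eq .
        moreover have "(2 * h)\<^sup>2 \<le> n\<^sup>2" by (intro power_mono) (auto simp: h_def)
        then have "K * (2 * h)\<^sup>2 \<le> K * n\<^sup>2" by (rule mult_left_mono) simp
        then have "(2 * K * h\<^sup>2 + 2 * K * h\<^sup>2) + K * n\<^sup>2 \<le> 2 * K * n\<^sup>2"
          by (simp add: power2_eq_square algebra_simps)
        ultimately show ?thesis by (rule pierceable_mono) simp
      qed
    qed
  qed
  then show ?thesis using assms by blast
qed

section \<open>Intervals on several tracks\<close>

text \<open>After sorting by \<open>key\<close>, every \<open>s\<close>-th entry is taken. The
  positions from the first to the last entry in a convex \<open>B\<close> form a run of length at
  least \<open>s\<close>, which contains a chosen position. A list is used so that repeated points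
  count with multiplicity.\<close>

lemma sorted_net:
  fixes key :: "'a \<Rightarrow> real"
  assumes "s \<ge> 1"
  shows "\<exists>S\<subseteq>set xs. card S \<le> length xs div s \<and>
    (\<forall>B. (\<forall>u\<in>set xs. \<forall>v\<in>set xs. \<forall>w\<in>set xs. u \<in> B \<longrightarrow> v \<in> B \<longrightarrow> key u \<le> key w \<longrightarrow> key w \<le> key v \<longrightarrow> w \<in> B)
      \<longrightarrow> s \<le> length (filter (\<lambda>x. x \<in> B) xs) \<longrightarrow> S \<inter> B \<noteq> {})"
proof -
  define ys where "ys = sort_key key xs"
  have ys: "set ys = set xs" "length ys = length xs" by (simp_all add: ys_def)
  have mono: "key (ys ! i) \<le> key (ys ! j)" if "i \<le> j" "j < length ys" for i j
  proof -
    have "sorted (map key ys)" by (simp add: ys_def)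
    then show ?thesis using that by (auto simp: sorted_iff_nth_mono)
  qed
  \<comment> \<open>The last entry of each complete block of \<open>s\<close>; there are exactly
    \<open>length xs div s\<close> such blocks.\<close>
  define S where "S = (\<lambda>q. ys ! (q * s + (s - 1))) ` {..<length xs div s}"
  have idx: "q * s + (s - 1) < length ys \<longleftrightarrow> q < length xs div s" for q
  proof -
    have "q < length xs div s \<longleftrightarrow> Suc q * s \<le> length xs"
      using \<open>s \<ge> 1\<close> less_eq_div_iff_mult_less_eq[of s "Suc q" "length xs"] by (simp add: Suc_le_eq)
    then show ?thesis using \<open>s \<ge> 1\<close> ys(2) by auto
  qed
  have "S \<subseteq> set ys"
  proof
    fix y assume "y \<in> S"
    then obtain q where q: "q < length xs div s" "y = ys ! (q * s + (s - 1))" by (auto simp: S_def)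
    then show "y \<in> set ys" using idx[of q] nth_mem by metis
  qed
  then have "S \<subseteq> set xs" by (simp only: ys)
  moreover have "card S \<le> length xs div s"
    unfolding S_def using card_image_le[of "{..<length xs div s}"] by simp
  moreover have "S \<inter> B \<noteq> {}"
    if conv: "\<forall>u\<in>set xs. \<forall>v\<in>set xs. \<forall>w\<in>set xs. u \<in> B \<longrightarrow> v \<in> B \<longrightarrow> key u \<le> key w \<longrightarrow> key w \<le> key v \<longrightarrow> w \<in> B"
      and many: "s \<le> length (filter (\<lambda>x. x \<in> B) xs)" for B
  proof -
    define J where "J = {i. i < length ys \<and> ys ! i \<in> B}"
    have "mset (filter (\<lambda>x. x \<in> B) ys) = mset (filter (\<lambda>x. x \<in> B) xs)"
      by (simp add: ys_def)
    then have "length (filter (\<lambda>x. x \<in> B) ys) = length (filter (\<lambda>x. x \<in> B) xs)"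
      by (metis size_mset)
    then have cardJ: "s \<le> card J" using many by (simp add: J_def length_filter_conv_card)
    have finJ: "finite J" by (simp add: J_def)
    have "J \<noteq> {}" using cardJ \<open>s \<ge> 1\<close> by auto
    define l where "l = Min J"
    have l: "l \<in> J" "\<And>i. i \<in> J \<Longrightarrow> l \<le> i" using finJ \<open>J \<noteq> {}\<close> by (auto simp: l_def)
    have m: "Max J \<in> J" using finJ \<open>J \<noteq> {}\<close> by simp
    have "J \<subseteq> {l..Max J}" using l finJ by auto
    then have "card J \<le> Suc (Max J) - l" using card_mono[of "{l..Max J}" J] by simp
    \<comment> \<open>The end \<open>i\<close> of the block containing \<open>l\<close> is at most
      \<open>s - 1\<close> positions after \<open>l\<close>, hence not beyond
      \<open>Max J\<close>.\<close>
    define q where "q = l div s"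
    define i where "i = q * s + (s - 1)"
    have "q * s + l mod s = l" unfolding q_def by (rule div_mult_mod_eq)
    moreover have "l mod s < s" using \<open>s \<ge> 1\<close> by simp
    ultimately have i: "l \<le> i" "i \<le> Max J"
      using \<open>card J \<le> Suc (Max J) - l\<close> cardJ \<open>s \<ge> 1\<close> unfolding i_def by linarith+
    have "Max J < length ys" "ys ! Max J \<in> B" "l < length ys" "ys ! l \<in> B" using l m by (auto simp: J_def)
    then have "ys ! i \<in> B"
      using conv mono[of l i] mono[of i "Max J"] i ys(1) by (metis le_less_trans nth_mem)
    moreover have "i < length ys" using i \<open>Max J < length ys\<close> by simp
    then have "ys ! i \<in> S" using idx[of q] by (auto simp: S_def i_def)
    ultimately show ?thesis by blast
  qed
  ultimately show ?thesis by blast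
qed

text \<open>Fractional covers are obtained by multiplicative weights: a member is halved in weight each
  time it is hit.\<close>

lemma multiplicative_weights:
  fixes K :: real
  assumes "finite \<F>" "K \<ge> 1"
    and heavy: "\<And>w :: 'a set \<Rightarrow> real. (\<And>B. w B > 0) \<Longrightarrow>
      \<exists>v\<in>V. sum w \<F> \<le> K * sum w {B \<in> \<F>. v \<in> B}"
  shows "\<exists>xs. length xs = T \<and> set xs \<subseteq> V \<and>
    (\<Sum>B\<in>\<F>. (1/2) ^ length (filter (\<lambda>x. x \<in> B) xs)) \<le> real (card \<F>) * (1 - 1 / (2 * K)) ^ T"
proof (induction T)
  case 0
  then show ?case by (intro exI[of _ "[]"]) simp
next
  case (Suc T)
  then obtain xs where xs: "length xs = T" "set xs \<subseteq> V"
    "(\<Sum>B\<in>\<F>. (1/2) ^ length (filter (\<lambda>x. x \<in> B) xs)) \<le> real (card \<F>) * (1 - 1 / (2 * K)) ^ T"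
    by blast
  define w :: "'a set \<Rightarrow> real" where "w B = (1/2) ^ length (filter (\<lambda>x. x \<in> B) xs)" for B
  obtain v where v: "v \<in> V" "sum w \<F> \<le> K * sum w {B \<in> \<F>. v \<in> B}"
    using heavy[of w] by (auto simp: w_def)
  have "(\<Sum>B\<in>\<F>. (1/2) ^ length (filter (\<lambda>x. x \<in> B) (v # xs))) = (\<Sum>B\<in>\<F>. w B - (if v \<in> B then w B / 2 else 0))"
    by (rule sum.cong) (auto simp: w_def)
  also have "\<dots> = sum w \<F> - sum w {B \<in> \<F>. v \<in> B} / 2"
    using \<open>finite \<F>\<close> by (simp add: sum_subtractf sum_divide_distrib sum.If_cases Int_def conj_commute)
  \<comment> \<open>The members containing \<open>v\<close> carry at least a share
    \<open>1 / K\<close> of the weight and lose half of it.\<close>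
  also have "\<dots> \<le> sum w \<F> * (1 - 1 / (2 * K))"
    using v(2) \<open>K \<ge> 1\<close> by (simp add: field_simps)
  also have "\<dots> \<le> (real (card \<F>) * (1 - 1 / (2 * K)) ^ T) * (1 - 1 / (2 * K))"
    using xs(3) \<open>K \<ge> 1\<close> by (intro mult_right_mono) (auto simp: w_def field_simps)
  finally show ?case using xs v(1) by (intro exI[of _ "v # xs"]) (simp add: mult_ac)
qed

text \<open>Abstracts the staircases of the four quadrants: each track is ordered by its key,
  members cut out intervals on it, and any two members that meet in \<open>P\<close> already meet on
  some track.\<close>

locale interval_tracks =
  fixes P :: "'a set" and \<F> :: "'a set set" and I :: "'i set"
    and M :: "'i \<Rightarrow> 'a set" and key :: "'i \<Rightarrow> 'a \<Rightarrow> real"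
  assumes finite_\<F>: "finite \<F>" and finite_I: "finite I"
    and finite_M: "i \<in> I \<Longrightarrow> finite (M i)" and M_subset: "i \<in> I \<Longrightarrow> M i \<subseteq> P"
    and interval: "i \<in> I \<Longrightarrow> B \<in> \<F> \<Longrightarrow> u \<in> M i \<inter> B \<Longrightarrow> v \<in> M i \<inter> B \<Longrightarrow> w \<in> M i \<Longrightarrow>
      key i u \<le> key i w \<Longrightarrow> key i w \<le> key i v \<Longrightarrow> w \<in> B"
    and meet: "B \<in> \<F> \<Longrightarrow> B' \<in> \<F> \<Longrightarrow> B \<inter> B' \<inter> P \<noteq> {} \<Longrightarrow> \<exists>i\<in>I. M i \<inter> B \<inter> B' \<noteq> {}"
    and trace_nonempty: "B \<in> \<F> \<Longrightarrow> B \<inter> P \<noteq> {}"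
begin

definition leftmost :: "'i \<Rightarrow> 'a set \<Rightarrow> 'a" where
  "leftmost i B = arg_min_on (key i) (M i \<inter> B)"

lemma leftmost:
  assumes "i \<in> I" "M i \<inter> B \<noteq> {}"
  shows "leftmost i B \<in> M i \<inter> B" "v \<in> M i \<inter> B \<Longrightarrow> key i (leftmost i B) \<le> key i v"
proof -
  have "finite (M i \<inter> B)" using assms finite_M by blast
  then show "leftmost i B \<in> M i \<inter> B" "v \<in> M i \<inter> B \<Longrightarrow> key i (leftmost i B) \<le> key i v"
    using arg_min_if_finite[of "M i \<inter> B" "key i"] assms(2) unfolding leftmost_def
    by (auto simp: not_less)
qed

text \<open>The guard discards the arbitrary value of \<open>leftmost i B\<close> on a track that
  \<open>B\<close> misses.\<close>

definition starts_in :: "'i \<Rightarrow> 'a set \<Rightarrow> 'a set \<Rightarrow> bool" where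
  "starts_in i B B' \<longleftrightarrow> M i \<inter> B \<noteq> {} \<and> leftmost i B \<in> B'"

text \<open>Of two intersecting intervals, one contains the left end of the other.\<close>

lemma conflict_starts_in:
  assumes "B \<in> \<F>" "B' \<in> \<F>" "B \<inter> B' \<inter> P \<noteq> {}"
  shows "\<exists>i\<in>I. starts_in i B B' \<or> starts_in i B' B"
proof -
  obtain i v where i: "i \<in> I" and v: "v \<in> M i" "v \<in> B" "v \<in> B'" using meet[OF assms] by blast
  have L: "leftmost i B \<in> M i \<inter> B" "key i (leftmost i B) \<le> key i v"
    and L': "leftmost i B' \<in> M i \<inter> B'" "key i (leftmost i B') \<le> key i v"
    using leftmost[OF i, of B] leftmost[OF i, of B'] v by blast+
  show ?thesis
  proof (cases "key i (leftmost i B) \<le> key i (leftmost i B')")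
    case True
    then have "leftmost i B' \<in> B" using interval[OF i assms(1) L(1), of v] L' v by blast
    then show ?thesis using i v by (auto simp: starts_in_def)
  next
    case False
    then have "leftmost i B \<in> B'" using interval[OF i assms(2) L'(1), of v] L v by auto
    then show ?thesis using i v by (auto simp: starts_in_def)
  qed
qed

text \<open>Averaging over pairs weighted by \<open>w B * w B'\<close>: each conflict is charged to
  a left end, and \<open>B\<close> has at most one left end per track, where the total weight is at
  most \<open>\<delta>\<close>. The factor 2 comes from the two orders of a pair.\<close>

lemma exists_light_neighbourhood:
  fixes w :: "'a set \<Rightarrow> real"
  assumes w: "\<And>B. w B > 0" and "\<delta> \<ge> 0"
    and \<delta>: "\<And>i v. i \<in> I \<Longrightarrow> v \<in> M i \<Longrightarrow> sum w {B \<in> \<F>. v \<in> B} \<le> \<delta>"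
    and \<G>: "\<G> \<subseteq> \<F>" "\<G> \<noteq> {}"
  shows "\<exists>B\<in>\<G>. sum w {B' \<in> \<G>. B \<inter> B' \<inter> P \<noteq> {}} \<le> 2 * real (card I) * \<delta>"
proof (rule ccontr)
  assume "\<not> ?thesis"
  then have heavy: "2 * real (card I) * \<delta> < sum w {B' \<in> \<G>. B \<inter> B' \<inter> P \<noteq> {}}" if "B \<in> \<G>" for B
    using that by force
  have fin: "finite \<G>" using \<G>(1) finite_\<F> finite_subset by blast
  define c where "c i B B' = w B * w B' * of_bool (starts_in i B B')" for i B B'
  have "(\<Sum>B\<in>\<G>. w B * (2 * real (card I) * \<delta>)) < (\<Sum>B\<in>\<G>. w B * sum w {B' \<in> \<G>. B \<inter> B' \<inter> P \<noteq> {}})"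
    using fin \<G>(2) heavy w by (intro sum_strict_mono mult_strict_left_mono) auto
  also have "\<dots> = (\<Sum>B\<in>\<G>. \<Sum>B'\<in>\<G>. w B * w B' * of_bool (B \<inter> B' \<inter> P \<noteq> {}))"
    using fin by (intro sum.cong refl) (simp add: sum_distrib_left sum.inter_filter if_distrib of_bool_def cong: if_cong)
  also have "\<dots> \<le> (\<Sum>B\<in>\<G>. \<Sum>B'\<in>\<G>. \<Sum>i\<in>I. c i B B' + c i B' B)"
  proof (intro sum_mono)
    fix B B' assume BB: "B \<in> \<G>" "B' \<in> \<G>"
    have nonneg: "0 \<le> c i B B' + c i B' B" for i
      using less_imp_le[OF w[of B]] less_imp_le[OF w[of B']] by (simp add: c_def)
    show "w B * w B' * of_bool (B \<inter> B' \<inter> P \<noteq> {}) \<le> (\<Sum>i\<in>I. c i B B' + c i B' B)"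
    proof (cases "B \<inter> B' \<inter> P = {}")
      case True
      then show ?thesis using nonneg by (simp add: sum_nonneg)
    next
      case False
      then obtain i where i: "i \<in> I" "starts_in i B B' \<or> starts_in i B' B"
        using conflict_starts_in \<G>(1) BB by blast
      then have "w B * w B' \<le> c i B B' + c i B' B"
        using less_imp_le[OF w[of B]] less_imp_le[OF w[of B']] by (auto simp: c_def mult_ac)
      also have "\<dots> \<le> (\<Sum>i\<in>I. c i B B' + c i B' B)"
        using nonneg i(1) finite_I by (intro member_le_sum) auto
      finally show ?thesis using False by simp
    qed
  qed
  also have "\<dots> = (\<Sum>B\<in>\<G>. \<Sum>B'\<in>\<G>. \<Sum>i\<in>I. c i B B') + (\<Sum>B\<in>\<G>. \<Sum>B'\<in>\<G>. \<Sum>i\<in>I. c i B' B)"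
    by (simp add: sum.distrib)
  \<comment> \<open>Exchanging the roles of \<open>B\<close> and \<open>B'\<close> identifies the
    two charges.\<close>
  also have "(\<Sum>B\<in>\<G>. \<Sum>B'\<in>\<G>. \<Sum>i\<in>I. c i B' B) = (\<Sum>B\<in>\<G>. \<Sum>B'\<in>\<G>. \<Sum>i\<in>I. c i B B')"
    by (rule sum.swap)
  also have "(\<Sum>B\<in>\<G>. \<Sum>B'\<in>\<G>. \<Sum>i\<in>I. c i B B') \<le> (\<Sum>B\<in>\<G>. w B * (real (card I) * \<delta>))"
  proof (rule sum_mono)
    fix B assume B: "B \<in> \<G>"
    have "(\<Sum>B'\<in>\<G>. c i B B') \<le> w B * \<delta>" if i: "i \<in> I" for i
    proof (cases "M i \<inter> B = {}")
      case True
      then show ?thesis using less_imp_le[OF w[of B]] \<open>\<delta> \<ge> 0\<close> by (simp add: c_def starts_in_def)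
    next
      case False
      then have "(\<Sum>B'\<in>\<G>. c i B B') = w B * sum w {B' \<in> \<G>. leftmost i B \<in> B'}"
        using fin by (simp add: c_def starts_in_def sum_distrib_left sum.inter_filter if_distrib of_bool_def cong: if_cong)
      also have "sum w {B' \<in> \<G>. leftmost i B \<in> B'} \<le> sum w {B' \<in> \<F>. leftmost i B \<in> B'}"
        using finite_\<F> \<G>(1) less_imp_le[OF w] by (intro sum_mono2) auto
      also have "\<dots> \<le> \<delta>" using \<delta> i leftmost(1)[OF i False] by blast
      finally show ?thesis using w[of B] by simp
    qed
    then have "(\<Sum>i\<in>I. \<Sum>B'\<in>\<G>. c i B B') \<le> (\<Sum>i\<in>I. w B * \<delta>)" by (rule sum_mono)
    also have "(\<Sum>i\<in>I. \<Sum>B'\<in>\<G>. c i B B') = (\<Sum>B'\<in>\<G>. \<Sum>i\<in>I. c i B B')" by (rule sum.swap)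
    finally show "(\<Sum>B'\<in>\<G>. \<Sum>i\<in>I. c i B B') \<le> w B * (real (card I) * \<delta>)" by (simp add: mult_ac)
  qed
  finally show False by (simp add: sum_distrib_left mult_ac)
qed

text \<open>Greedy choice: pick a member with a light neighbourhood, delete the neighbourhood and
  repeat. Each picked member uses up weight at most \<open>2 * card I * \<delta>\<close>.\<close>

lemma exists_heavy_packing:
  fixes w :: "'a set \<Rightarrow> real"
  assumes w: "\<And>B. w B > 0" and "\<delta> \<ge> 0"
    and \<delta>: "\<And>i v. i \<in> I \<Longrightarrow> v \<in> M i \<Longrightarrow> sum w {B \<in> \<F>. v \<in> B} \<le> \<delta>"
    and "\<G> \<subseteq> \<F>"
  shows "\<exists>A\<subseteq>\<G>. disjoint_family_on (\<lambda>B. B \<inter> P) A \<and> sum w \<G> \<le> 2 * real (card I) * \<delta> * real (card A)"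
proof -
  have "finite \<G>" using \<open>\<G> \<subseteq> \<F>\<close> finite_\<F> finite_subset by blast
  then show ?thesis using \<open>\<G> \<subseteq> \<F>\<close>
  proof (induction \<G> rule: finite_psubset_induct)
    case (psubset \<G>)
    show ?case
    proof (cases "\<G> = {}")
      case True
      then show ?thesis by (auto simp: disjoint_family_on_def)
    next
      case False
      define nb where "nb B = {B' \<in> \<G>. B \<inter> B' \<inter> P \<noteq> {}}" for B
      have "\<exists>B\<in>\<G>. sum w (nb B) \<le> 2 * real (card I) * \<delta>"
        unfolding nb_def
        by (rule exists_light_neighbourhood) (use w \<open>\<delta> \<ge> 0\<close> \<delta> psubset.prems False in auto)
      then obtain B where B: "B \<in> \<G>" "sum w (nb B) \<le> 2 * real (card I) * \<delta>" by blast
      have "B \<in> nb B" using B(1) psubset.prems trace_nonempty by (auto simp: nb_def)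
      have sub: "nb B \<subseteq> \<G>" by (auto simp: nb_def)
      have smaller: "\<G> - nb B \<subset> \<G>" "\<G> - nb B \<subseteq> \<F>"
        using \<open>B \<in> nb B\<close> B(1) psubset.prems by blast+
      then obtain A where A: "A \<subseteq> \<G> - nb B" "disjoint_family_on (\<lambda>B. B \<inter> P) A"
        "sum w (\<G> - nb B) \<le> 2 * real (card I) * \<delta> * real (card A)"
        using psubset.IH[OF smaller] by blast
      have "B \<notin> A" using A(1) \<open>B \<in> nb B\<close> by blast
      have "finite A" using A(1) psubset.hyps finite_subset by blast
      have "B \<inter> B' \<inter> P = {}" if "B' \<in> A" for B' using that A(1) by (auto simp: nb_def)
      then have "disjoint_family_on (\<lambda>B. B \<inter> P) (insert B A)"
        using A(2) unfolding disjoint_family_on_def by blast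
      moreover have "sum w \<G> = sum w (\<G> - nb B) + sum w (nb B)"
        using sum.subset_diff[OF sub \<open>finite \<G>\<close>] .
      then have "sum w \<G> \<le> 2 * real (card I) * \<delta> * real (card (insert B A))"
        using A(3) B(2) \<open>B \<notin> A\<close> \<open>finite A\<close> by (simp add: algebra_simps)
      moreover have "insert B A \<subseteq> \<G>" using A(1) B(1) by blast
      ultimately show ?thesis by blast
    qed
  qed
qed

text \<open>With \<open>\<delta>\<close> the largest weight at a track point, a packing of at most
  \<open>n\<close> members bounds the total weight. This supplies the hypothesis of
  \<open>multiplicative_weights\<close>.\<close>

lemma exists_heavy_point:
  fixes w :: "'a set \<Rightarrow> real"
  assumes w: "\<And>B. w B > 0" and "packing_le P \<F> n" "\<F> \<noteq> {}"
  shows "\<exists>v\<in>(\<Union>i\<in>I. M i). sum w \<F> \<le> real (2 * card I * n) * sum w {B \<in> \<F>. v \<in> B}"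
proof -
  let ?V = "\<Union>i\<in>I. M i"
  define wt where "wt v = sum w {B \<in> \<F>. v \<in> B}" for v
  define \<delta> where "\<delta> = Max (wt ` ?V)"
  obtain B where "B \<in> \<F>" using \<open>\<F> \<noteq> {}\<close> by blast
  then have "?V \<noteq> {}" using meet[of B B] trace_nonempty by auto
  moreover have "finite ?V" using finite_I finite_M by blast
  ultimately have "\<delta> \<in> wt ` ?V" "\<And>v. v \<in> ?V \<Longrightarrow> wt v \<le> \<delta>"
    unfolding \<delta>_def by (auto intro: Max_in)
  then obtain v where v: "v \<in> ?V" "\<delta> = wt v" by blast
  have "\<delta> \<ge> 0" unfolding v(2) wt_def using w by (simp add: sum_nonneg less_imp_le)
  then obtain A where A: "A \<subseteq> \<F>" "disjoint_family_on (\<lambda>B. B \<inter> P) A"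
    "sum w \<F> \<le> 2 * real (card I) * \<delta> * real (card A)"
    using exists_heavy_packing[of w \<delta> \<F>] w \<open>\<And>v. v \<in> ?V \<Longrightarrow> wt v \<le> \<delta>\<close> unfolding wt_def by blast
  then have "card A \<le> n" using assms(2) unfolding packing_le_def by blast
  then have "2 * real (card I) * \<delta> * real (card A) \<le> 2 * real (card I) * \<delta> * real n"
    using \<open>\<delta> \<ge> 0\<close> by (intro mult_left_mono) auto
  then have "sum w \<F> \<le> real (2 * card I * n) * wt v" using A(3) v(2) by (simp add: mult_ac)
  then show ?thesis using v(1) unfolding wt_def by blast
qed

text \<open>The factors: a fractional cover by \<open>4 * K * card I * s\<close> points, \<open>K = 2 * card I * n\<close>, hits each
  member \<open>card I * s\<close> times, hence \<open>s\<close> times within one track, where every \<open>s\<close>-th point suffices.\<close>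

lemma pierceable_tracks:
  assumes "packing_le P \<F> n"
  shows "pierceable P \<F> (8 * card I ^ 3 * n)"
proof (cases "\<F> = {}")
  case True
  then show ?thesis using pierceable_empty by simp
next
  case False
  define d where "d = card I"
  define m where "m = card \<F>"
  define K where "K = 2 * d * n"
  \<comment> \<open>Here \<open>s\<close> is \<open>m\<close>, so the decay
    \<open>exp (- 2 * d * m)\<close> absorbs the initial weight \<open>m\<close> and still leaves
    \<open>exp (- d * m)\<close>, which forces \<open>d * m\<close> hits on every member.\<close>
  define T where "T = 4 * K * d * m"
  have "n \<ge> 1" using assms False packing_le_0 finite_\<F> by (cases n) auto
  obtain B0 where "B0 \<in> \<F>" using False by blast
  then have "I \<noteq> {}" using meet[of B0 B0] trace_nonempty by auto
  then have "d \<ge> 1" using finite_I by (simp add: d_def Suc_le_eq card_gt_0_iff)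
  have "m \<ge> 1" using False finite_\<F> by (simp add: m_def Suc_le_eq card_gt_0_iff)
  have "K \<ge> 1" using \<open>n \<ge> 1\<close> \<open>d \<ge> 1\<close> by (simp add: K_def)
  have "\<exists>v\<in>(\<Union>i\<in>I. M i). sum w \<F> \<le> real K * sum w {B \<in> \<F>. v \<in> B}" if "\<And>B. w B > 0" for w
    using exists_heavy_point[OF that assms False] by (simp add: K_def d_def)
  then obtain xs where xs: "length xs = T" "set xs \<subseteq> (\<Union>i\<in>I. M i)"
    "(\<Sum>B\<in>\<F>. (1/2) ^ length (filter (\<lambda>x. x \<in> B) xs)) \<le> real m * (1 - 1 / (2 * real K)) ^ T"
    using multiplicative_weights[OF finite_\<F>, of "real K" "\<Union>i\<in>I. M i" T] \<open>K \<ge> 1\<close> unfolding m_def by auto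
  define xsi where "xsi i = filter (\<lambda>x. x \<in> M i) xs" for i

  have many: "d * m \<le> length (filter (\<lambda>x. x \<in> B) xs)" if B: "B \<in> \<F>" for B
  proof -
    let ?h = "length (filter (\<lambda>x. x \<in> B) xs)"
    have "(1 - 1 / (2 * real K)) ^ T \<le> exp (- (1 / (2 * real K))) ^ T"
      using exp_ge_add_one_self[of "- (1 / (2 * real K))"] \<open>K \<ge> 1\<close> by (intro power_mono) (auto simp: field_simps)
    also have "\<dots> = exp (- (real T * (1 / (2 * real K))))" by (simp flip: exp_of_nat_mult)
    also have "real T * (1 / (2 * real K)) = 2 * real (d * m)" using \<open>K \<ge> 1\<close> by (simp add: T_def)
    finally have decay: "(1 - 1 / (2 * real K)) ^ T \<le> exp (- (2 * real (d * m)))" .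
    have "real m \<le> exp (real m)" using exp_ge_add_one_self[of "real m"] by linarith
    also have "m \<le> d * m" using \<open>d \<ge> 1\<close> by simp
    then have "exp (real m) \<le> exp (real (d * m))" by (simp only: exp_le_cancel_iff of_nat_le_iff)
    finally have m_le: "real m \<le> exp (real (d * m))" .
    have "(1/2) ^ ?h \<le> (\<Sum>B\<in>\<F>. (1/2::real) ^ length (filter (\<lambda>x. x \<in> B) xs))"
      using B finite_\<F> by (intro member_le_sum) auto
    also have "\<dots> \<le> real m * (1 - 1 / (2 * real K)) ^ T" by (rule xs(3))
    also have "\<dots> \<le> exp (real (d * m)) * exp (- (2 * real (d * m)))"
      using decay m_le \<open>K \<ge> 1\<close> by (intro mult_mono) (auto simp: field_simps)
    also have "\<dots> = exp (- real (d * m))" by (simp flip: exp_add)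
    also have "\<dots> = exp (- 1) ^ (d * m)" by (simp flip: exp_of_nat_mult)
    also have "\<dots> \<le> (1/2) ^ (d * m)"
    proof (rule power_mono)
      have "exp 1 \<ge> (2::real)" using exp_ge_add_one_self[of "1::real"] by simp
      then show "exp (- 1) \<le> (1/2::real)" by (simp add: exp_minus field_simps)
    qed simp
    finally have "(1/2::real) ^ ?h \<le> (1/2) ^ (d * m)" .
    then show ?thesis by (subst (asm) power_decreasing_iff) auto
  qed

  \<comment> \<open>Only an inequality, since tracks may share points.\<close>
  have split: "length (filter (\<lambda>x. x \<in> B) ys) \<le> (\<Sum>i\<in>I. length (filter (\<lambda>x. x \<in> B) (filter (\<lambda>x. x \<in> M i) ys)))"
    if "set ys \<subseteq> (\<Union>i\<in>I. M i)" for ys B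
    using that
  proof (induction ys)
    case (Cons y ys)
    define L where "L i = length (filter (\<lambda>x. x \<in> B) (filter (\<lambda>x. x \<in> M i) ys))" for i
    obtain i where i: "i \<in> I" "y \<in> M i" using Cons.prems by auto
    have "(\<Sum>i\<in>I. length (filter (\<lambda>x. x \<in> B) (filter (\<lambda>x. x \<in> M i) (y # ys)))) =
        (\<Sum>i\<in>I. L i + of_bool (y \<in> B \<and> y \<in> M i))"
      by (rule sum.cong) (auto simp: L_def)
    also have "\<dots> = (\<Sum>i\<in>I. L i) + (\<Sum>i\<in>I. of_bool (y \<in> B \<and> y \<in> M i))" by (rule sum.distrib)
    finally have eq: "(\<Sum>i\<in>I. length (filter (\<lambda>x. x \<in> B) (filter (\<lambda>x. x \<in> M i) (y # ys)))) =
        (\<Sum>i\<in>I. L i) + (\<Sum>i\<in>I. of_bool (y \<in> B \<and> y \<in> M i))" .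
    have "of_bool (y \<in> B \<and> y \<in> M i) \<le> (\<Sum>i\<in>I. of_bool (y \<in> B \<and> y \<in> M i) :: nat)"
      using finite_I i by (intro member_le_sum) auto
    moreover have "length (filter (\<lambda>x. x \<in> B) ys) \<le> (\<Sum>i\<in>I. L i)" using Cons unfolding L_def by simp
    ultimately show ?case unfolding eq using i(2) by auto
  qed simp

  have "\<exists>S. \<forall>i. S i \<subseteq> set (xsi i) \<and> card (S i) \<le> length (xsi i) div m \<and>
    (\<forall>B. (\<forall>u\<in>set (xsi i). \<forall>v\<in>set (xsi i). \<forall>w\<in>set (xsi i). u \<in> B \<longrightarrow> v \<in> B \<longrightarrow>
        key i u \<le> key i w \<longrightarrow> key i w \<le> key i v \<longrightarrow> w \<in> B)
      \<longrightarrow> m \<le> length (filter (\<lambda>x. x \<in> B) (xsi i)) \<longrightarrow> S i \<inter> B \<noteq> {})"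
    by (intro choice allI sorted_net \<open>m \<ge> 1\<close>)
  then obtain S where S: "\<And>i. S i \<subseteq> set (xsi i)" "\<And>i. card (S i) \<le> length (xsi i) div m"
    "\<And>i B. (\<forall>u\<in>set (xsi i). \<forall>v\<in>set (xsi i). \<forall>w\<in>set (xsi i). u \<in> B \<longrightarrow> v \<in> B \<longrightarrow>
        key i u \<le> key i w \<longrightarrow> key i w \<le> key i v \<longrightarrow> w \<in> B) \<Longrightarrow>
      m \<le> length (filter (\<lambda>x. x \<in> B) (xsi i)) \<Longrightarrow> S i \<inter> B \<noteq> {}"
    by metis

  show ?thesis
    unfolding pierceable_def
  proof (intro exI conjI ballI)
    have xsi_sub: "set (xsi i) \<subseteq> M i" for i by (auto simp: xsi_def)
    show "(\<Union>i\<in>I. S i) \<subseteq> P" using S(1) xsi_sub M_subset by blast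
    show "finite (\<Union>i\<in>I. S i)" using finite_I S(1) finite_subset by blast
    have "card (\<Union>i\<in>I. S i) \<le> (\<Sum>i\<in>I. card (S i))" using finite_I by (rule card_UN_le)
    also have "\<dots> \<le> (\<Sum>i\<in>I. 4 * K * d)"
    proof (rule sum_mono)
      fix i
      have "card (S i) \<le> length (xsi i) div m" by (rule S(2))
      \<comment> \<open>Each track is charged for all \<open>T\<close> points, which costs a further
        factor \<open>d\<close> in the sum over the tracks.\<close>
      also have "\<dots> \<le> T div m"
        using xs(1) length_filter_le[of _ xs] unfolding xsi_def by (intro div_le_mono) auto
      also have "\<dots> = 4 * K * d" using \<open>m \<ge> 1\<close> by (simp add: T_def)
      finally show "card (S i) \<le> 4 * K * d" .
    qed
    also have "\<dots> = 8 * card I ^ 3 * n" by (simp add: K_def power3_eq_cube d_def)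
    finally show "card (\<Union>i\<in>I. S i) \<le> 8 * card I ^ 3 * n" .
    fix B assume B: "B \<in> \<F>"
    have "\<exists>i\<in>I. m \<le> length (filter (\<lambda>x. x \<in> B) (xsi i))"
    proof (rule ccontr)
      assume "\<not> ?thesis"
      then have "(\<Sum>i\<in>I. length (filter (\<lambda>x. x \<in> B) (xsi i))) \<le> (\<Sum>i\<in>I. m - 1)"
        by (intro sum_mono) force
      from le_trans[OF many[OF B] le_trans[OF split[OF xs(2)] this[unfolded xsi_def]]]
      have "d * m \<le> d * (m - 1)" by (simp add: d_def)
      then show False using \<open>m \<ge> 1\<close> \<open>d \<ge> 1\<close> by simp
    qed
    then obtain i where i: "i \<in> I" "m \<le> length (filter (\<lambda>x. x \<in> B) (xsi i))" by blast
    have "S i \<inter> B \<noteq> {}"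
    proof (rule S(3)[OF _ i(2)], intro ballI impI)
      fix u v w assume "u \<in> set (xsi i)" "v \<in> set (xsi i)" "w \<in> set (xsi i)" "u \<in> B" "v \<in> B"
        "key i u \<le> key i w" "key i w \<le> key i v"
      then show "w \<in> B" using interval[OF i(1) B, of u v w] xsi_sub by blast
    qed
    then show "(\<Union>i\<in>I. S i) \<inter> B \<noteq> {}" using i(1) by blast
  qed
qed

end

section \<open>Boxes in the plane\<close>

text \<open>Around a common point of all boxes, each quadrant sees a box only through the staircase of
  minimal points of \<open>P\<close>, and it cuts out an interval of the staircase.\<close>

lemma quadrant_convex:
  fixes \<omega> u v w :: "real ^ 2"
  assumes "axis_parallel_box B" "\<omega> \<in> B" "u \<in> B" "v \<in> B" and \<sigma>: "\<sigma> \<in> {- 1, 1}" "\<tau> \<in> {- 1, 1 :: real}"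
    and "0 \<le> \<sigma> * (w $ 1 - \<omega> $ 1)" "\<sigma> * (w $ 1 - \<omega> $ 1) \<le> \<sigma> * (v $ 1 - \<omega> $ 1)"
    and "0 \<le> \<tau> * (w $ 2 - \<omega> $ 2)" "\<tau> * (w $ 2 - \<omega> $ 2) \<le> \<tau> * (u $ 2 - \<omega> $ 2)"
  shows "w \<in> B"
proof -
  obtain a b where "B = cbox a b" using assms(1) by (auto simp: axis_parallel_box_def)
  then show ?thesis using assms(2-) by (auto simp: mem_box_cart forall_2)
qed

text \<open>In each quadrant at \<open>\<omega>\<close> a box is downward closed towards
  \<open>\<omega>\<close>, so two boxes meeting at \<open>z\<close> also share a minimal point below
  \<open>z\<close>. With four tracks the constant is \<open>8 * 4 ^ 3 = 512\<close>.\<close>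

lemma pierceable_common_point:
  fixes \<omega> :: "real ^ 2"
  assumes "finite P" "finite \<F>"
    and box: "\<And>B. B \<in> \<F> \<Longrightarrow> axis_parallel_box B \<and> \<omega> \<in> B \<and> B \<inter> P \<noteq> {}"
    and "packing_le P \<F> n"
  shows "pierceable P \<F> (512 * n)"
proof -
  define I :: "(real \<times> real) set" where "I = {- 1, 1} \<times> {- 1, 1}"
  define key where "key \<sigma> z = fst \<sigma> * (z $ 1 - \<omega> $ 1)" for \<sigma> :: "real \<times> real" and z :: "real ^ 2"
  define key' where "key' \<sigma> z = snd \<sigma> * (z $ 2 - \<omega> $ 2)" for \<sigma> :: "real \<times> real" and z :: "real ^ 2"
  define Q where "Q \<sigma> = {z \<in> P. 0 \<le> key \<sigma> z \<and> 0 \<le> key' \<sigma> z}" for \<sigma>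
  \<comment> \<open>Ties in \<open>key'\<close> are allowed; this minimality is what makes
    \<open>key'\<close> weakly decreasing in \<open>key\<close> along
    \<open>M \<sigma>\<close>.\<close>
  define M where "M \<sigma> = {z \<in> Q \<sigma>. \<forall>u\<in>Q \<sigma>. key \<sigma> u \<le> key \<sigma> z \<longrightarrow> key' \<sigma> u \<le> key' \<sigma> z \<longrightarrow> key' \<sigma> u = key' \<sigma> z}" for \<sigma>
  have finQ: "finite (Q \<sigma>)" for \<sigma> using \<open>finite P\<close> by (simp add: Q_def)
  have convex: "w \<in> B"
    if "\<sigma> \<in> I" "B \<in> \<F>" "u \<in> B" "v \<in> B" "w \<in> Q \<sigma>" "key \<sigma> w \<le> key \<sigma> v" "key' \<sigma> w \<le> key' \<sigma> u" for \<sigma> B u v w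
    using that quadrant_convex[of B \<omega> u v "fst \<sigma>" "snd \<sigma>" w] box[of B]
    by (auto simp: I_def key_def key'_def Q_def)
  interpret interval_tracks P \<F> I M key
  proof
    show "finite \<F>" "finite I" by (auto simp: I_def \<open>finite \<F>\<close>)
    show "finite (M \<sigma>)" for \<sigma> using finQ by (simp add: M_def)
    show "M \<sigma> \<subseteq> P" for \<sigma> by (auto simp: M_def Q_def)
    show "B \<inter> P \<noteq> {}" if "B \<in> \<F>" for B using box that by blast
    show "w \<in> B"
      if "\<sigma> \<in> I" "B \<in> \<F>" "u \<in> M \<sigma> \<inter> B" "v \<in> M \<sigma> \<inter> B" "w \<in> M \<sigma>" "key \<sigma> u \<le> key \<sigma> w" "key \<sigma> w \<le> key \<sigma> v"
      for \<sigma> B u v w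
    proof (rule convex[OF that(1,2)])
      have "u \<in> Q \<sigma>" using that(3) by (simp add: M_def)
      then have "key' \<sigma> u \<le> key' \<sigma> w \<Longrightarrow> key' \<sigma> u = key' \<sigma> w" using that(5,6) by (simp add: M_def)
      then show "key' \<sigma> w \<le> key' \<sigma> u" by linarith
    qed (use that in \<open>auto simp: M_def\<close>)
    show "\<exists>\<sigma>\<in>I. M \<sigma> \<inter> B \<inter> B' \<noteq> {}" if "B \<in> \<F>" "B' \<in> \<F>" and meet: "B \<inter> B' \<inter> P \<noteq> {}" for B B'
    proof -
      obtain z where z: "z \<in> B" "z \<in> B'" "z \<in> P" using meet by blast
      define \<sigma> :: "real \<times> real" where
        "\<sigma> = (if z $ 1 \<ge> \<omega> $ 1 then 1 else - 1, if z $ 2 \<ge> \<omega> $ 2 then 1 else - 1)"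
      have "\<sigma> \<in> I" by (simp add: \<sigma>_def I_def)
      define D where "D = {u \<in> Q \<sigma>. key \<sigma> u \<le> key \<sigma> z \<and> key' \<sigma> u \<le> key' \<sigma> z}"
      have "z \<in> D" using z(3) by (auto simp: D_def Q_def \<sigma>_def key_def key'_def)
      then have "D \<noteq> {}" by blast
      have "finite D" using finQ by (simp add: D_def)
      \<comment> \<open>Minimising the sum of both coordinates below \<open>z\<close> gives a
        staircase point.\<close>
      define v where "v = arg_min_on (\<lambda>u. key \<sigma> u + key' \<sigma> u) D"
      have v: "v \<in> D" "\<And>u. u \<in> D \<Longrightarrow> key \<sigma> v + key' \<sigma> v \<le> key \<sigma> u + key' \<sigma> u"
        using arg_min_if_finite[OF \<open>finite D\<close> \<open>D \<noteq> {}\<close>, of "\<lambda>u. key \<sigma> u + key' \<sigma> u"]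
        unfolding v_def by (auto simp: not_less)
      have "v \<in> M \<sigma>"
        unfolding M_def
      proof (intro CollectI conjI ballI impI)
        show "v \<in> Q \<sigma>" using v(1) by (simp add: D_def)
        fix u assume u: "u \<in> Q \<sigma>" "key \<sigma> u \<le> key \<sigma> v" "key' \<sigma> u \<le> key' \<sigma> v"
        then have "u \<in> D" using v(1) by (simp add: D_def)
        then show "key' \<sigma> u = key' \<sigma> v" using v(2)[of u] u by linarith
      qed
      moreover have "v \<in> B" "v \<in> B'"
        using convex[OF \<open>\<sigma> \<in> I\<close>, of _ z z v] that z v(1) by (auto simp: D_def)
      ultimately show ?thesis using \<open>\<sigma> \<in> I\<close> by blast
    qed
  qed
  have "card I = 4" by (simp add: I_def)
  then show ?thesis using pierceable_tracks[OF assms(4)] by simp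
qed

text \<open>Boxes crossing both a vertical and a horizontal line contain the intersection of the two
  lines. Each of the two halvings doubles the constant 512.\<close>

lemma pierceable_boxes:
  fixes P :: "(real ^ 2) set"
  assumes "finite P" "finite \<F>"
    and box: "\<And>B. B \<in> \<F> \<Longrightarrow> axis_parallel_box B \<and> B \<inter> P \<noteq> {}"
    and "packing_le P \<F> n"
  shows "pierceable P \<F> (2048 * n\<^sup>2)"
proof -
  have "\<forall>B\<in>\<F>. \<exists>a b. (\<forall>i. a $ i \<le> b $ i) \<and> B = cbox a b"
    using box by (auto simp: axis_parallel_box_def)
  then obtain lo hi :: "(real ^ 2) set \<Rightarrow> real ^ 2"
    where lohi: "\<And>B i. B \<in> \<F> \<Longrightarrow> lo B $ i \<le> hi B $ i" "\<And>B. B \<in> \<F> \<Longrightarrow> B = cbox (lo B) (hi B)"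
    by metis
  have proj: "lo B $ i \<le> z $ i \<and> z $ i \<le> hi B $ i" if "B \<in> \<F>" "z \<in> B" for B z i
    using lohi(2)[OF that(1)] that(2) by (metis mem_box_cart(2))
  have nonempty: "{} \<notin> \<F>" using box by blast
  have common: "pierceable P \<G> (512 * m\<^sup>2)"
    if "\<G> \<subseteq> \<F>" "\<forall>B\<in>\<G>. lo B $ 1 \<le> x \<and> x \<le> hi B $ 1" "\<forall>B\<in>\<G>. lo B $ 2 \<le> y \<and> y \<le> hi B $ 2" "packing_le P \<G> m"
    for \<G> x y m
  proof -
    have "vector [x, y] \<in> B" if "B \<in> \<G>" for B
    proof -
      have "vector [x, y] \<in> cbox (lo B) (hi B)"
        using that \<open>\<forall>B\<in>\<G>. lo B $ 1 \<le> x \<and> x \<le> hi B $ 1\<close> \<open>\<forall>B\<in>\<G>. lo B $ 2 \<le> y \<and> y \<le> hi B $ 2\<close>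
        by (simp add: mem_box_cart forall_2)
      then show ?thesis using lohi(2) that \<open>\<G> \<subseteq> \<F>\<close> by blast
    qed
    then have "pierceable P \<G> (512 * m)"
      using \<open>finite P\<close> finite_subset[OF \<open>\<G> \<subseteq> \<F>\<close> \<open>finite \<F>\<close>] box \<open>\<G> \<subseteq> \<F>\<close> \<open>packing_le P \<G> m\<close>
      by (intro pierceable_common_point[where \<omega> = "vector [x, y]"]) auto
    \<comment> \<open>The linear bound is weakened to the quadratic form that the halving lemma
      takes as input.\<close>
    then show ?thesis by (rule pierceable_mono) (auto simp: power2_eq_square)
  qed
  have strip: "pierceable P \<G> (2 * 512 * m\<^sup>2)"
    if \<G>: "\<G> \<subseteq> \<F>" "\<forall>B\<in>\<G>. lo B $ 1 \<le> x \<and> x \<le> hi B $ 1" "packing_le P \<G> m" for \<G> x m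
  proof (rule pierceable_by_halving[where lo = "\<lambda>B. lo B $ 2" and hi = "\<lambda>B. hi B $ 2" and \<pi> = "\<lambda>z. z $ 2"])
    show "finite \<G>" using \<G>(1) \<open>finite \<F>\<close> finite_subset by blast
    show "{} \<notin> \<G>" using \<G>(1) nonempty by blast
    show "lo B $ 2 \<le> z $ 2 \<and> z $ 2 \<le> hi B $ 2" if "B \<in> \<G>" "z \<in> B" for B z using that proj \<G>(1) by blast
    show "pierceable P \<H> (512 * l\<^sup>2)"
      if "\<H> \<subseteq> \<G>" "\<forall>B\<in>\<H>. lo B $ 2 \<le> c \<and> c \<le> hi B $ 2" "packing_le P \<H> l" for \<H> c l
      using that \<G> by (intro common[where x = x and y = c]) auto
  qed (rule \<G>(3))
  have "pierceable P \<F> (2 * (2 * 512) * n\<^sup>2)"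
    by (rule pierceable_by_halving[where lo = "\<lambda>B. lo B $ 1" and hi = "\<lambda>B. hi B $ 1" and \<pi> = "\<lambda>z. z $ 1"])
      (use \<open>finite \<F>\<close> nonempty proj strip assms(4) in auto)
  then show ?thesis by simp
qed

section \<open>Rectangles of words\<close>

text \<open>Words over the digits 0, 1, 2. The rectangle with index \<open>(i, w)\<close>, where \<open>w i = 2\<close>, consists of
  the pairs \<open>(X, Y)\<close> such that \<open>X\<close> agrees with \<open>w\<close> up to position \<open>i\<close> and \<open>Y\<close> agrees with \<open>w\<close> from
  position \<open>i\<close> on.\<close>

definition words :: "nat \<Rightarrow> (nat \<Rightarrow> nat) set" where
  "words k = {..<k} \<rightarrow>\<^sub>E {..<3}"

definition rect_index :: "nat \<Rightarrow> (nat \<times> (nat \<Rightarrow> nat)) set" where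
  "rect_index k = (SIGMA i:{..<k}. {w \<in> words k. w i = 2})"

definition in_rect :: "nat \<Rightarrow> (nat \<Rightarrow> nat) \<times> (nat \<Rightarrow> nat) \<Rightarrow> nat \<times> (nat \<Rightarrow> nat) \<Rightarrow> bool" where
  "in_rect k z r \<longleftrightarrow> (\<forall>l\<le>fst r. fst z l = snd r l) \<and> (\<forall>l. fst r \<le> l \<and> l < k \<longrightarrow> snd z l = snd r l)"

definition levels :: "nat \<Rightarrow> (nat \<Rightarrow> nat) \<times> (nat \<Rightarrow> nat) \<Rightarrow> nat set" where
  "levels k z = {i. i < k \<and> fst z i = 2 \<and> snd z i = 2}"

text \<open>Two levels are just enough for a point to witness a conflict of two rectangles, and they
  keep every point in at most two rectangles.\<close>

definition shallow :: "nat \<Rightarrow> ((nat \<Rightarrow> nat) \<times> (nat \<Rightarrow> nat)) set" where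
  "shallow k = {z \<in> words k \<times> words k. card (levels k z) \<le> 2}"

definition rect_conflict :: "nat \<Rightarrow> nat \<times> (nat \<Rightarrow> nat) \<Rightarrow> nat \<times> (nat \<Rightarrow> nat) \<Rightarrow> bool" where
  "rect_conflict k r s \<longleftrightarrow> (\<exists>z\<in>shallow k. in_rect k z r \<and> in_rect k z s)"

lemma finite_words [simp]: "finite (words k)"
  by (simp add: words_def finite_PiE)

lemma finite_rect_index: "finite (rect_index k)"
  by (simp add: rect_index_def)

lemma word_digit: "w \<in> words k \<Longrightarrow> l < k \<Longrightarrow> w l < 3"
  by (auto simp: words_def)

lemma word_eqI: "v \<in> words k \<Longrightarrow> w \<in> words k \<Longrightarrow> (\<And>l. l < k \<Longrightarrow> v l = w l) \<Longrightarrow> v = w"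
  unfolding words_def by (auto intro: PiE_ext)

lemma word_upd: "w \<in> words k \<Longrightarrow> i < k \<Longrightarrow> d < 3 \<Longrightarrow> w(i := d) \<in> words k"
  by (auto simp: words_def PiE_def extensional_def Pi_def)

lemma card_word_slice:
  assumes "i < k" "d < 3"
  shows "card {w \<in> words k. w i = d} = 3 ^ (k - 1)"
proof -
  have "{w \<in> words k. w i = d} = (\<Pi>\<^sub>E l\<in>{..<k}. if l = i then {d} else {..<3})"
    using assms by (auto simp: words_def PiE_def Pi_def extensional_def split: if_splits)
  then have "card {w \<in> words k. w i = d} = (\<Prod>l<k. if l = i then 1 else 3)"
    by (simp add: card_PiE if_distrib cong: if_cong)
  also have "\<dots> = (\<Prod>l\<in>{..<k} - {i}. 3)"
    using assms(1) by (subst prod.remove[of _ i]) (auto intro!: prod.cong)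
  also have "\<dots> = 3 ^ (k - 1)"
    using assms(1) by simp
  finally show ?thesis .
qed

lemma card_rect_index: "card (rect_index k) = k * 3 ^ (k - 1)"
  by (simp add: rect_index_def card_word_slice)

text \<open>A rectangle containing \<open>z\<close> is determined by its level, since its word can
  be read off from \<open>z\<close>, and that level belongs to \<open>levels k z\<close>.\<close>

lemma card_rects_at_shallow_point:
  assumes "z \<in> shallow k"
  shows "finite {r \<in> rect_index k. in_rect k z r}" "card {r \<in> rect_index k. in_rect k z r} \<le> 2"
proof -
  show fin: "finite {r \<in> rect_index k. in_rect k z r}" using finite_rect_index by simp
  have "inj_on fst {r \<in> rect_index k. in_rect k z r}"
  proof (rule inj_onI)
    fix r s assume r: "r \<in> {r \<in> rect_index k. in_rect k z r}" and s: "s \<in> {r \<in> rect_index k. in_rect k z r}"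
      and eq: "fst r = fst s"
    have "snd r = snd s"
    proof (rule word_eqI)
      show "snd r \<in> words k" "snd s \<in> words k" using r s by (auto simp: rect_index_def)
      show "snd r l = snd s l" if "l < k" for l
        using r s eq that by (cases "l \<le> fst r") (auto simp: in_rect_def)
    qed
    then show "r = s" using eq by (simp add: prod_eq_iff)
  qed
  moreover have "fst ` {r \<in> rect_index k. in_rect k z r} \<subseteq> levels k z"
    by (auto simp: rect_index_def in_rect_def levels_def)
  moreover have "finite (levels k z)" by (simp add: levels_def)
  ultimately have "card {r \<in> rect_index k. in_rect k z r} \<le> card (levels k z)"
    by (metis card_image card_mono)
  then show "card {r \<in> rect_index k. in_rect k z r} \<le> 2" using assms by (simp add: shallow_def)
qed

lemma rect_meets_shallow:
  assumes "r \<in> rect_index k"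
  shows "\<exists>z\<in>shallow k. in_rect k z r"
proof -
  obtain i w where r: "r = (i, w)" "i < k" "w \<in> words k" "w i = 2"
    using assms by (auto simp: rect_index_def)
  \<comment> \<open>Filling the free digits with 0 leaves \<open>i\<close> as the only level; the
    guard \<open>l < k\<close> keeps \<open>X\<close> undefined beyond \<open>k\<close>.\<close>
  define X where "X l = (if l < k \<and> l > i then 0 else w l)" for l
  define Y where "Y l = (if l < i then 0 else w l)" for l
  have "X \<in> words k" "Y \<in> words k"
    using r by (auto simp: X_def Y_def words_def PiE_def extensional_def Pi_def)
  moreover have "levels k (X, Y) \<subseteq> {i}" by (auto simp: levels_def X_def Y_def)
  then have "card (levels k (X, Y)) \<le> 2" using card_mono[of "{i}" "levels k (X, Y)"] by simp
  ultimately have "(X, Y) \<in> shallow k" by (simp add: shallow_def)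
  moreover have "in_rect k (X, Y) r" using r by (auto simp: in_rect_def X_def Y_def)
  ultimately show ?thesis by blast
qed

text \<open>The sample space of the second moment argument.\<close>

definition diff_pairs :: "nat \<Rightarrow> ((nat \<Rightarrow> nat) \<times> (nat \<Rightarrow> nat)) set" where
  "diff_pairs k = {z \<in> words k \<times> words k. \<forall>l<k. fst z l \<noteq> snd z l}"

text \<open>The word of the level-\<open>i\<close> rectangle that a pair selects; it ignores \<open>X i\<close> and \<open>Y i\<close>.\<close>

definition splice_word :: "nat \<Rightarrow> (nat \<Rightarrow> nat) \<times> (nat \<Rightarrow> nat) \<Rightarrow> nat \<Rightarrow> nat" where
  "splice_word i z l = (if l < i then fst z l else if l = i then 2 else snd z l)"

text \<open>Changing \<open>X j\<close> and \<open>Y i\<close> to 2 gives a point of both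
  rectangles. As \<open>X\<close> and \<open>Y\<close> differ everywhere, no levels other than
  \<open>i\<close> and \<open>j\<close> arise.\<close>

lemma selected_conflict:
  assumes z: "z \<in> diff_pairs k" and "i < j" "j < k" "fst z i = 2" "snd z j = 2"
  shows "rect_conflict k (i, splice_word i z) (j, splice_word j z)"
proof -
  obtain X Y where XY: "z = (X, Y)" by (cases z)
  let ?z = "(X(j := 2), Y(i := 2))"
  have "levels k ?z \<subseteq> {i, j}" using z assms(2-) by (auto simp: levels_def XY diff_pairs_def)
  then have "card (levels k ?z) \<le> 2"
    using card_mono[of "{i, j}" "levels k ?z"] \<open>i < j\<close> by simp
  then have "?z \<in> shallow k"
    using z assms(2-) by (auto simp: shallow_def XY diff_pairs_def intro!: word_upd)
  moreover have "in_rect k ?z (i, splice_word i z)" "in_rect k ?z (j, splice_word j z)"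
    using assms(2-) by (auto simp: in_rect_def splice_word_def XY)
  ultimately show ?thesis unfolding rect_conflict_def by blast
qed


section \<open>Counting the pairs that select a given word\<close>

lemma card_words_avoiding:
  assumes "\<And>l. l < k \<Longrightarrow> c l < 3"
  shows "card (\<Pi>\<^sub>E l\<in>{..<k}. {..<3} - {c l :: nat}) = 2 ^ k"
proof -
  have "card (\<Pi>\<^sub>E l\<in>{..<k}. {..<3} - {c l}) = (\<Prod>l<k. card ({..<3} - {c l}))"
    by (simp add: card_PiE)
  also have "\<dots> = (\<Prod>l<k. 2)"
    by (rule prod.cong) (use assms in auto)
  finally show ?thesis by simp
qed

lemma finite_diff_pairs [simp]: "finite (diff_pairs k)"
  by (simp add: diff_pairs_def)

lemma card_diff_pairs: "card (diff_pairs k) = 6 ^ k"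
proof -
  have "diff_pairs k = (SIGMA X:words k. \<Pi>\<^sub>E l\<in>{..<k}. {..<3} - {X l})"
    by (auto simp: diff_pairs_def words_def PiE_def Pi_def extensional_def)
  moreover have "card (\<Pi>\<^sub>E l\<in>{..<k}. {..<3} - {X l}) = 2 ^ k" if "X \<in> words k" for X
    using that word_digit by (intro card_words_avoiding)
  ultimately have "card (diff_pairs k) = card (words k) * 2 ^ k"
    by (simp add: card_SigmaI finite_PiE)
  also have "\<dots> = 6 ^ k" by (simp add: words_def card_PiE flip: power_mult_distrib)
  finally show ?thesis .
qed

text \<open>The conditions fix one digit of the pair at every position, namely \<open>X l\<close>
  for \<open>l \<le> i\<close> and \<open>Y l\<close> for \<open>l > i\<close>, collected in
  \<open>c\<close>. The other digit has two choices; \<open>h\<close> inserts these digits and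
  \<open>g\<close> extracts them.\<close>

lemma card_splice_fibre:
  assumes w: "w \<in> words k" "i < k" "w i = 2" and "a < 3"
  shows "card {z \<in> diff_pairs k. splice_word i z = w \<and> fst z i = a} = 2 ^ k"
proof -
  define c where "c = w(i := a)"
  define h where "h v = (\<lambda>l. if l \<le> i then c l else v l, \<lambda>l. if l \<le> i then v l else c l)" for v :: "nat \<Rightarrow> nat"
  define g where "g z l = (if l \<le> i then snd z l else fst z l)" for z :: "(nat \<Rightarrow> nat) \<times> (nat \<Rightarrow> nat)" and l
  have c: "c l < 3" if "l < k" for l using w that \<open>a < 3\<close> word_digit by (auto simp: c_def)
  have c_undef: "c l = undefined" if "\<not> l < k" for l
    using w that by (auto simp: c_def words_def PiE_def extensional_def)
  have c_splice: "c l = (if l \<le> i then fst z l else snd z l)" if "splice_word i z = w" "fst z i = a" for z l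
    using that(2) unfolding c_def that(1)[symmetric] by (simp add: splice_word_def)
  let ?A = "\<Pi>\<^sub>E l\<in>{..<k}. {..<3} - {c l}"
  let ?B = "{z \<in> diff_pairs k. splice_word i z = w \<and> fst z i = a}"
  have "bij_betw h ?A ?B"
  proof (rule bij_betw_byWitness[where f' = g])
    show "\<forall>v\<in>?A. g (h v) = v" by (intro ballI ext) (simp add: g_def h_def)
    show "\<forall>z\<in>?B. h (g z) = z"
    proof
      fix z assume z: "z \<in> ?B"
      have "splice_word i z = w" "fst z i = a" using z by simp_all
      then have "c l = (if l \<le> i then fst z l else snd z l)" for l by (rule c_splice)
      then show "h (g z) = z" by (simp add: g_def h_def prod_eq_iff fun_eq_iff)
    qed
    show "h ` ?A \<subseteq> ?B"
    proof
      fix z assume "z \<in> h ` ?A"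
      then obtain v where v: "z = h v" "v \<in> ?A" by (rule imageE)
      have v': "v l < 3" "v l \<noteq> c l" if "l < k" for l using PiE_mem[OF v(2), of l] that by simp_all
      have vu: "v l = undefined" if "\<not> l < k" for l using PiE_arb[OF v(2), of l] that by simp
      have "fst z \<in> words k" "snd z \<in> words k"
        using v' vu c c_undef unfolding v(1) by (auto simp: h_def words_def PiE_def Pi_def extensional_def)
      moreover have "fst z l \<noteq> snd z l" if "l < k" for l using v'(2)[OF that] by (auto simp: v(1) h_def)
      moreover have "splice_word i z = w" using w by (auto simp: v(1) h_def splice_word_def c_def)
      moreover have "fst z i = a" by (simp add: v(1) h_def c_def)
      ultimately show "z \<in> ?B" by (cases z) (auto simp: diff_pairs_def)
    qed
    show "g ` ?B \<subseteq> ?A"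
    proof
      fix v assume "v \<in> g ` ?B"
      then obtain X Y where z: "(X, Y) \<in> diff_pairs k" "splice_word i (X, Y) = w" "X i = a" "v = g (X, Y)"
        by auto
      have cl: "c l = (if l \<le> i then X l else Y l)" for l
        using c_splice[OF z(2)] z(3) by simp
      show "v \<in> ?A"
        using z(1) unfolding z(4)
        by (auto simp: g_def cl diff_pairs_def words_def PiE_def Pi_def extensional_def)
    qed
  qed
  then have "card ?B = card ?A" by (simp add: bij_betw_same_card)
  also have "\<dots> = 2 ^ k" using c by (rule card_words_avoiding)
  finally show ?thesis .
qed

lemma card_splice_fibre_all:
  assumes w: "w \<in> words k" "i < k" "w i = 2"
  shows "card {z \<in> diff_pairs k. splice_word i z = w} = 3 * 2 ^ k"
proof -
  have "{z \<in> diff_pairs k. splice_word i z = w} = (\<Union>a<3. {z \<in> diff_pairs k. splice_word i z = w \<and> fst z i = a})"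
    using assms word_digit by (auto simp: diff_pairs_def)
  also have "card \<dots> = (\<Sum>a<3. card {z \<in> diff_pairs k. splice_word i z = w \<and> fst z i = a})"
    by (rule card_UN_disjoint) auto
  also have "\<dots> = 3 * 2 ^ k" using card_splice_fibre[OF assms] by simp
  finally show ?thesis .
qed

section \<open>Cancellation by sign-reversing involutions\<close>

lemma sum_split:
  assumes "finite A"
  shows "sum g A = sum g {z \<in> A. Q z} + sum g {z \<in> A. \<not> Q z}"
proof -
  have "sum g ({z \<in> A. Q z} \<union> {z \<in> A. \<not> Q z}) = sum g {z \<in> A. Q z} + sum g {z \<in> A. \<not> Q z}"
    by (rule sum.union_disjoint) (use assms in auto)
  moreover have "{z \<in> A. Q z} \<union> {z \<in> A. \<not> Q z} = A" by blast
  ultimately show ?thesis by simp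
qed

lemma sum_eq_0_of_involution:
  fixes g :: "'b \<Rightarrow> real"
  assumes "\<And>z. z \<in> A \<Longrightarrow> T z \<in> A" "\<And>z. z \<in> A \<Longrightarrow> T (T z) = z" "\<And>z. z \<in> A \<Longrightarrow> g (T z) = - g z"
  shows "sum g A = 0"
proof -
  have "sum g A = sum (\<lambda>z. - g z) A"
    by (rule sum.reindex_bij_witness[of _ T T]) (use assms in auto)
  then show ?thesis by (simp add: sum_negf)
qed

text \<open>For a fixed digit \<open>x\<close>, the signs of the pairs \<open>(x, y)\<close> with \<open>y \<noteq> x\<close> cancel unless \<open>x = 2\<close>, and
  symmetrically in the second digit.\<close>

definition sgn2 :: "nat \<Rightarrow> (nat \<Rightarrow> nat) \<times> (nat \<Rightarrow> nat) \<Rightarrow> real" where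
  "sgn2 i z = (if fst z i = 2 \<or> snd z i = 2 then 1 else - 1)"

text \<open>For distinct digits \<open>x\<close> and \<open>y\<close> in \<open>{0, 1, 2}\<close>,
  \<open>3 - x - y\<close> is the third digit.\<close>

definition swap_snd :: "nat \<Rightarrow> (nat \<Rightarrow> nat) \<times> (nat \<Rightarrow> nat) \<Rightarrow> (nat \<Rightarrow> nat) \<times> (nat \<Rightarrow> nat)" where
  "swap_snd i z = (fst z, (snd z)(i := 3 - fst z i - snd z i))"

definition swap_fst :: "nat \<Rightarrow> (nat \<Rightarrow> nat) \<times> (nat \<Rightarrow> nat) \<Rightarrow> (nat \<Rightarrow> nat) \<times> (nat \<Rightarrow> nat)" where
  "swap_fst i z = ((fst z)(i := 3 - fst z i - snd z i), snd z)"

lemma diff_pairs_digit_cases: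
  assumes "z \<in> diff_pairs k" "i < k"
  shows "(fst z i, snd z i) \<in> {(0, 1), (0, 2), (1, 0), (1, 2), (2, 0), (2, 1)}"
proof -
  have "fst z i < 3" "snd z i < 3" "fst z i \<noteq> snd z i"
    using assms word_digit by (auto simp: diff_pairs_def)
  then show ?thesis by (auto simp: numeral_3_eq_3 numeral_2_eq_2 less_Suc_eq)
qed

lemma swap_snd:
  assumes "z \<in> diff_pairs k" "i < k"
  shows "swap_snd i z \<in> diff_pairs k" "swap_snd i (swap_snd i z) = z"
    "fst z i \<noteq> 2 \<Longrightarrow> sgn2 i (swap_snd i z) = - sgn2 i z"
proof -
  note cases = diff_pairs_digit_cases[OF assms]
  have "3 - fst z i - snd z i < 3" using cases by auto
  then show "swap_snd i z \<in> diff_pairs k"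
    using assms cases by (auto simp: swap_snd_def diff_pairs_def intro!: word_upd)
  show "swap_snd i (swap_snd i z) = z"
    using cases by (auto simp: swap_snd_def prod_eq_iff fun_eq_iff)
  show "sgn2 i (swap_snd i z) = - sgn2 i z" if "fst z i \<noteq> 2"
    using cases that by (auto simp: swap_snd_def sgn2_def)
qed

lemma swap_fst:
  assumes "z \<in> diff_pairs k" "i < k"
  shows "swap_fst i z \<in> diff_pairs k" "swap_fst i (swap_fst i z) = z"
    "snd z i \<noteq> 2 \<Longrightarrow> sgn2 i (swap_fst i z) = - sgn2 i z"
proof -
  note cases = diff_pairs_digit_cases[OF assms]
  have "3 - fst z i - snd z i < 3" using cases by auto
  then show "swap_fst i z \<in> diff_pairs k"
    using assms cases by (auto simp: swap_fst_def diff_pairs_def intro!: word_upd)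
  show "swap_fst i (swap_fst i z) = z"
    using cases by (auto simp: swap_fst_def prod_eq_iff fun_eq_iff)
  show "sgn2 i (swap_fst i z) = - sgn2 i z" if "snd z i \<noteq> 2"
    using cases that by (auto simp: swap_fst_def sgn2_def)
qed


text \<open>Each rectangle family without conflicts is tested against the function
  \<open>\<Sum>i. f i * sgn2 i\<close> on \<open>diff_pairs k\<close>, where \<open>f i\<close> indicates that the rectangle selected at level \<open>i\<close> is in
  the family. Its mixed terms sum to zero: swapping a digit cancels everything outside
  \<open>fst z i = 2 = snd z j\<close>, and there the two selected rectangles conflict.\<close>

lemma mixed_sum_eq_0:
  fixes f :: "nat \<Rightarrow> (nat \<Rightarrow> nat) \<times> (nat \<Rightarrow> nat) \<Rightarrow> real"
  assumes "i < j" "j < k"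
    and f: "\<And>i. f i = (\<lambda>z. of_bool ((i, splice_word i z) \<in> S))"
    and indep: "\<And>r s. r \<in> S \<Longrightarrow> s \<in> S \<Longrightarrow> r \<noteq> s \<Longrightarrow> \<not> rect_conflict k r s"
  shows "(\<Sum>z\<in>diff_pairs k. (f i z * sgn2 i z) * (f j z * sgn2 j z)) = 0"
proof -
  define g where "g z = (f i z * sgn2 i z) * (f j z * sgn2 j z)" for z
  have "i < k" using assms by simp
  \<comment> \<open>For \<open>i < j\<close>, neither selected word depends on \<open>Y i\<close> or
    on \<open>X j\<close>, so both swaps preserve \<open>f i\<close> and \<open>f j\<close>.\<close>
  have *: "splice_word i (swap_snd i z) = splice_word i z" "splice_word j (swap_snd i z) = splice_word j z"
    "sgn2 j (swap_snd i z) = sgn2 j z" "fst (swap_snd i z) = fst z"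
    "splice_word i (swap_fst j z) = splice_word i z" "splice_word j (swap_fst j z) = splice_word j z"
    "sgn2 i (swap_fst j z) = sgn2 i z" "fst (swap_fst j z) i = fst z i" "snd (swap_fst j z) = snd z" for z
    using \<open>i < j\<close> by (auto simp: splice_word_def swap_snd_def swap_fst_def sgn2_def fun_eq_iff)
  have 1: "sum g {z \<in> diff_pairs k. fst z i \<noteq> 2} = 0"
    by (rule sum_eq_0_of_involution[where T = "swap_snd i"])
      (auto simp: g_def f * swap_snd[OF _ \<open>i < k\<close>])
  have 2: "sum g {z \<in> diff_pairs k. fst z i = 2 \<and> snd z j \<noteq> 2} = 0"
    by (rule sum_eq_0_of_involution[where T = "swap_fst j"])
      (auto simp: g_def f * swap_fst[OF _ \<open>j < k\<close>])
  have 3: "sum g {z \<in> diff_pairs k. fst z i = 2 \<and> snd z j = 2} = 0"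
  proof (rule sum.neutral, rule ballI)
    fix z assume "z \<in> {z \<in> diff_pairs k. fst z i = 2 \<and> snd z j = 2}"
    then have "rect_conflict k (i, splice_word i z) (j, splice_word j z)"
      using selected_conflict assms(1,2) by blast
    then have "\<not> ((i, splice_word i z) \<in> S \<and> (j, splice_word j z) \<in> S)"
      using indep[of "(i, splice_word i z)" "(j, splice_word j z)"] \<open>i < j\<close> by auto
    then show "g z = 0" by (auto simp: g_def f)
  qed
  have "sum g (diff_pairs k) = sum g {z \<in> diff_pairs k. fst z i \<noteq> 2} + sum g {z \<in> diff_pairs k. fst z i = 2}"
    using sum_split[of "diff_pairs k" g "\<lambda>z. fst z i \<noteq> 2"] by simp
  also have "sum g {z \<in> diff_pairs k. fst z i = 2} =
      sum g {z \<in> diff_pairs k. fst z i = 2 \<and> snd z j \<noteq> 2} + sum g {z \<in> diff_pairs k. fst z i = 2 \<and> snd z j = 2}"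
    using sum_split[of "{z \<in> diff_pairs k. fst z i = 2}" g "\<lambda>z. snd z j \<noteq> 2"] by (simp add: conj_ac)
  finally show ?thesis using 1 2 3 by (simp add: g_def)
qed

text \<open>Since the mixed terms vanish, \<open>F\<close> has sum \<open>2 ^ k * card S\<close> and
  square sum \<open>3 * 2 ^ k * card S\<close> over \<open>6 ^ k\<close> pairs; Cauchy-Schwarz then
  bounds \<open>card S\<close>.\<close>

lemma card_conflict_free_le:
  assumes S: "S \<subseteq> rect_index k"
    and indep: "\<And>r s. r \<in> S \<Longrightarrow> s \<in> S \<Longrightarrow> r \<noteq> s \<Longrightarrow> \<not> rect_conflict k r s"
  shows "card S \<le> 3 ^ (k + 1)"
proof -
  define f :: "nat \<Rightarrow> (nat \<Rightarrow> nat) \<times> (nat \<Rightarrow> nat) \<Rightarrow> real"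
    where "f = (\<lambda>i z. of_bool ((i, splice_word i z) \<in> S))"
  define Si where "Si i = {w. (i, w) \<in> S}" for i
  define F where "F z = (\<Sum>i<k. f i z * sgn2 i z)" for z
  have Si: "w \<in> words k" "w i = 2" if "w \<in> Si i" for i w using that S by (auto simp: Si_def rect_index_def)
  have finSi: "finite (Si i)" for i using Si(1) by (intro finite_subset[OF _ finite_words]) auto
  have "S = (SIGMA i:{..<k}. Si i)" using S by (auto simp: Si_def rect_index_def)
  then have cardS: "card S = (\<Sum>i<k. card (Si i))" using finSi by simp

  have sum_fibres: "(\<Sum>z\<in>{z \<in> diff_pairs k. Q z}. f i z) = real (c * card (Si i))"
    if "\<And>w. w \<in> Si i \<Longrightarrow> card {z \<in> diff_pairs k. splice_word i z = w \<and> Q z} = c" for i Q c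
  proof -
    have "(\<Sum>z\<in>{z \<in> diff_pairs k. Q z}. f i z) = real (card {z \<in> {z \<in> diff_pairs k. Q z}. splice_word i z \<in> Si i})"
      by (simp add: f_def Si_def Int_def flip: sum.inter_filter)
    also have "{z \<in> {z \<in> diff_pairs k. Q z}. splice_word i z \<in> Si i} =
        (\<Union>w\<in>Si i. {z \<in> diff_pairs k. splice_word i z = w \<and> Q z})" by auto
    also have "card \<dots> = (\<Sum>w\<in>Si i. card {z \<in> diff_pairs k. splice_word i z = w \<and> Q z})"
      using finSi by (intro card_UN_disjoint) auto
    also have "\<dots> = c * card (Si i)" using that by simp
    finally show ?thesis .
  qed
  have sum_f: "(\<Sum>z\<in>diff_pairs k. f i z) = real (3 * 2 ^ k * card (Si i))" if "i < k" for i
  proof -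
    have "card {z \<in> diff_pairs k. splice_word i z = w} = 3 * 2 ^ k" if "w \<in> Si i" for w
      using card_splice_fibre_all Si[OF that] \<open>i < k\<close> by blast
    then show ?thesis using sum_fibres[of i "\<lambda>_. True" "3 * 2 ^ k"] by simp
  qed
  \<comment> \<open>After cancellation only pairs with \<open>X i = 2\<close> remain, where the sign
    is 1: a third of each fibre.\<close>
  have sum_fs: "(\<Sum>z\<in>diff_pairs k. f i z * sgn2 i z) = real (2 ^ k * card (Si i))" if "i < k" for i
  proof -
    have "splice_word i (swap_snd i z) = splice_word i z" "fst (swap_snd i z) = fst z" for z
      by (auto simp: splice_word_def swap_snd_def)
    then have "(\<Sum>z\<in>{z \<in> diff_pairs k. fst z i \<noteq> 2}. f i z * sgn2 i z) = 0"
      by (intro sum_eq_0_of_involution[where T = "swap_snd i"]) (auto simp: f_def swap_snd[OF _ that])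
    moreover have "(\<Sum>z\<in>diff_pairs k. f i z * sgn2 i z) =
        (\<Sum>z\<in>{z \<in> diff_pairs k. fst z i \<noteq> 2}. f i z * sgn2 i z) + (\<Sum>z\<in>{z \<in> diff_pairs k. fst z i = 2}. f i z * sgn2 i z)"
      using sum_split[of "diff_pairs k" "\<lambda>z. f i z * sgn2 i z" "\<lambda>z. fst z i \<noteq> 2"] by simp
    moreover have "(\<Sum>z\<in>{z \<in> diff_pairs k. fst z i = 2}. f i z * sgn2 i z) = (\<Sum>z\<in>{z \<in> diff_pairs k. fst z i = 2}. f i z)"
      by (rule sum.cong) (auto simp: sgn2_def)
    moreover have "card {z \<in> diff_pairs k. splice_word i z = w \<and> fst z i = 2} = 2 ^ k" if "w \<in> Si i" for w
      using card_splice_fibre Si[OF that] \<open>i < k\<close> by simp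
    ultimately show ?thesis using sum_fibres[of i "\<lambda>z. fst z i = 2" "2 ^ k"] by simp
  qed

  have "(\<Sum>z\<in>diff_pairs k. F z) = (\<Sum>i<k. \<Sum>z\<in>diff_pairs k. f i z * sgn2 i z)"
    unfolding F_def by (rule sum.swap)
  also have "\<dots> = 2 ^ k * real (card S)" by (simp add: sum_fs cardS sum_distrib_left)
  finally have sum_F: "(\<Sum>z\<in>diff_pairs k. F z) = 2 ^ k * real (card S)" .

  have "(\<Sum>z\<in>diff_pairs k. (F z)\<^sup>2) = (\<Sum>z\<in>diff_pairs k. \<Sum>i<k. \<Sum>j<k. (f i z * sgn2 i z) * (f j z * sgn2 j z))"
    by (simp add: F_def power2_eq_square sum_product)
  also have "\<dots> = (\<Sum>i<k. \<Sum>z\<in>diff_pairs k. \<Sum>j<k. (f i z * sgn2 i z) * (f j z * sgn2 j z))"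
    by (rule sum.swap)
  also have "\<dots> = (\<Sum>i<k. \<Sum>j<k. \<Sum>z\<in>diff_pairs k. (f i z * sgn2 i z) * (f j z * sgn2 j z))"
    by (intro sum.cong sum.swap refl)
  also have "\<dots> = (\<Sum>i<k. \<Sum>j<k. if i = j then real (3 * 2 ^ k * card (Si i)) else 0)"
  proof (intro sum.cong refl)
    fix i j assume ij: "i \<in> {..<k}" "j \<in> {..<k}"
    show "(\<Sum>z\<in>diff_pairs k. (f i z * sgn2 i z) * (f j z * sgn2 j z)) =
        (if i = j then real (3 * 2 ^ k * card (Si i)) else 0)"
    proof (cases i j rule: linorder_cases)
      case less
      then show ?thesis using ij mixed_sum_eq_0[of i j k f S] indep by (simp add: f_def)
    next
      case equal
      have "(\<Sum>z\<in>diff_pairs k. (f i z * sgn2 i z) * (f j z * sgn2 j z)) = (\<Sum>z\<in>diff_pairs k. f i z)"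
        unfolding equal by (rule sum.cong) (auto simp: f_def sgn2_def)
      then show ?thesis using sum_f[of i] ij equal by simp
    next
      case greater
      then show ?thesis using ij mixed_sum_eq_0[of j i k f S] indep by (simp add: f_def mult_ac)
    qed
  qed
  also have "\<dots> = 3 * 2 ^ k * real (card S)" by (simp add: cardS sum_distrib_left)
  finally have sum_F2: "(\<Sum>z\<in>diff_pairs k. (F z)\<^sup>2) = 3 * 2 ^ k * real (card S)" .

  have "(2 ^ k * real (card S))\<^sup>2 \<le> 3 * 2 ^ k * real (card S) * 6 ^ k"
    using sum_squared_le_sum_of_squares[of F "diff_pairs k"] by (simp add: sum_F sum_F2 card_diff_pairs)
  also have "(6::real) ^ k = 2 ^ k * 3 ^ k" by (simp flip: power_mult_distrib)
  finally have "(2 ^ k * 2 ^ k * real (card S)) * real (card S) \<le> (2 ^ k * 2 ^ k * real (card S)) * 3 ^ (k + 1)"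
    by (simp add: power2_eq_square mult_ac)
  then have "real (card S) \<le> 3 ^ (k + 1)"
    by (cases "card S = 0") (auto simp del: power_Suc simp: mult_le_cancel_left_pos)
  then have "real (card S) \<le> real (3 ^ (k + 1))" by simp
  then show ?thesis by (simp only: of_nat_le_iff)
qed

section \<open>Ternary values and the realisation by boxes\<close>

text \<open>Digit 0 is the most significant, so that words with a common prefix have consecutive
  values.\<close>

primrec dval :: "(nat \<Rightarrow> nat) \<Rightarrow> nat \<Rightarrow> nat" where
  "dval X 0 = 0"
| "dval X (Suc m) = 3 * dval X m + X m"

lemma dval_div:
  assumes "\<And>l. l < m + t \<Longrightarrow> X l < 3"
  shows "dval X (m + t) div 3 ^ t = dval X m"
  using assms
proof (induction t)
  case (Suc t)
  have "dval X (m + Suc t) div 3 ^ Suc t = (3 * dval X (m + t) + X (m + t)) div 3 div 3 ^ t"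
    by (simp add: div_mult2_eq)
  also have "(3 * dval X (m + t) + X (m + t)) div 3 = dval X (m + t)" using Suc.prems by simp
  finally show ?case using Suc by simp
qed simp

lemma dval_eq_iff:
  assumes "\<And>l. l < m \<Longrightarrow> X l < 3" "\<And>l. l < m \<Longrightarrow> W l < 3"
  shows "dval X m = dval W m \<longleftrightarrow> (\<forall>l<m. X l = W l)"
  using assms
proof (induction m)
  case (Suc m)
  have "X m < 3" "W m < 3" using Suc.prems by auto
  then have "dval X (Suc m) = dval W (Suc m) \<longleftrightarrow> dval X m = dval W m \<and> X m = W m"
    by simp presburger
  then show ?case using Suc by (auto simp: less_Suc_eq)
qed simp

text \<open>Division by \<open>3 ^ (k - m)\<close> strips all but the first \<open>m\<close> digits,
  which turns prefix agreement into an interval condition.\<close>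

lemma dval_cylinder:
  assumes "\<And>l. l < k \<Longrightarrow> X l < 3" "\<And>l. l < k \<Longrightarrow> W l < 3" "m \<le> k"
  shows "dval W m * 3 ^ (k - m) \<le> dval X k \<and> dval X k < Suc (dval W m) * 3 ^ (k - m)
    \<longleftrightarrow> (\<forall>l<m. X l = W l)"
proof -
  have "dval W m * 3 ^ (k - m) \<le> dval X k \<and> dval X k < Suc (dval W m) * 3 ^ (k - m)
      \<longleftrightarrow> dval X k div 3 ^ (k - m) = dval W m"
    using less_eq_div_iff_mult_less_eq[of "3 ^ (k - m)" "dval W m" "dval X k"]
      div_less_iff_less_mult[of "3 ^ (k - m)" "dval X k" "Suc (dval W m)"] by auto
  also have "dval X k div 3 ^ (k - m) = dval X m"
    using dval_div[of m "k - m" X] assms by simp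
  also have "dval X m = dval W m \<longleftrightarrow> (\<forall>l<m. X l = W l)"
    using assms by (intro dval_eq_iff) auto
  finally show ?thesis .
qed

text \<open>The second word is read backwards, so that fixing a final segment of it fixes leading digits.\<close>

definition word_point :: "nat \<Rightarrow> (nat \<Rightarrow> nat) \<times> (nat \<Rightarrow> nat) \<Rightarrow> real ^ 2" where
  "word_point k z = vector [real (dval (fst z) k), real (dval (\<lambda>l. snd z (k - 1 - l)) k)]"

text \<open>The corners are the extreme values of the two cylinders. Values are integers, so
  subtracting 1 turns the half-open ranges into closed ones.\<close>

definition word_box :: "nat \<Rightarrow> nat \<times> (nat \<Rightarrow> nat) \<Rightarrow> (real ^ 2) set" where
  "word_box k r = (let i = fst r; w = snd r; a = dval w (Suc i); b = dval (\<lambda>l. w (k - 1 - l)) (k - i) in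
     cbox (vector [real (a * 3 ^ (k - Suc i)), real (b * 3 ^ i)])
          (vector [real (Suc a * 3 ^ (k - Suc i)) - 1, real (Suc b * 3 ^ i) - 1]))"

lemma axis_parallel_word_box: "axis_parallel_box (word_box k r)"
proof -
  have "real (a * 3 ^ t) \<le> real (Suc a * 3 ^ t) - 1" for a t :: nat
    by (simp add: algebra_simps)
  then show ?thesis
    unfolding axis_parallel_box_def word_box_def Let_def by (intro exI conjI) (auto simp: forall_2 vector_2)
qed

lemma word_point_in_box_iff:
  assumes z: "z \<in> words k \<times> words k" and r: "r \<in> rect_index k"
  shows "word_point k z \<in> word_box k r \<longleftrightarrow> in_rect k z r"
proof -
  obtain X Y i w where eq: "z = (X, Y)" "r = (i, w)" by (metis surj_pair)
  have X: "X l < 3" and Y: "Y l < 3" and w: "w l < 3" if "l < k" for l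
    using z r that word_digit by (auto simp: eq rect_index_def)
  have "i < k" using r by (simp add: eq rect_index_def)
  have real_le: "real x \<le> real y - 1 \<longleftrightarrow> x < y" for x y by linarith
  let ?r = "\<lambda>v l. v (k - 1 - l)"
  have "word_point k z \<in> word_box k r \<longleftrightarrow>
      (dval w (Suc i) * 3 ^ (k - Suc i) \<le> dval X k \<and> dval X k < Suc (dval w (Suc i)) * 3 ^ (k - Suc i)) \<and>
      (dval (?r w) (k - i) * 3 ^ i \<le> dval (?r Y) k \<and> dval (?r Y) k < Suc (dval (?r w) (k - i)) * 3 ^ i)"
    by (simp only: word_point_def word_box_def Let_def eq fst_conv snd_conv mem_box_cart forall_2 vector_2
        real_le of_nat_le_iff)
  also have "(dval w (Suc i) * 3 ^ (k - Suc i) \<le> dval X k \<and> dval X k < Suc (dval w (Suc i)) * 3 ^ (k - Suc i))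
      \<longleftrightarrow> (\<forall>l<Suc i. X l = w l)"
    using \<open>i < k\<close> X w by (intro dval_cylinder) auto
  also have "(dval (?r w) (k - i) * 3 ^ i \<le> dval (?r Y) k \<and> dval (?r Y) k < Suc (dval (?r w) (k - i)) * 3 ^ i)
      \<longleftrightarrow> (\<forall>l<k - i. ?r Y l = ?r w l)"
    using \<open>i < k\<close> Y w dval_cylinder[of k "?r Y" "?r w" "k - i"] by auto
  also have "\<dots> \<longleftrightarrow> (\<forall>l. i \<le> l \<and> l < k \<longrightarrow> Y l = w l)"
  proof
    assume *: "\<forall>l<k - i. ?r Y l = ?r w l"
    show "\<forall>l. i \<le> l \<and> l < k \<longrightarrow> Y l = w l"
    proof (intro allI impI)
      fix l assume "i \<le> l \<and> l < k"
      then have "k - 1 - l < k - i" "k - 1 - (k - 1 - l) = l" by auto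
      then show "Y l = w l" using * by metis
    qed
  qed auto
  also have "(\<forall>l<Suc i. X l = w l) \<and> (\<forall>l. i \<le> l \<and> l < k \<longrightarrow> Y l = w l) \<longleftrightarrow> in_rect k z r"
    by (auto simp: in_rect_def eq less_Suc_eq_le)
  finally show ?thesis .
qed

section \<open>The lower bound\<close>

lemma le_piercing_number:
  assumes "\<And>S. finite S \<Longrightarrow> \<forall>F\<in>\<F>. S \<inter> F \<noteq> {} \<Longrightarrow> m \<le> card S"
  shows "enat m \<le> piercing_number \<F>"
  unfolding piercing_number_def by (rule Inf_greatest) (use assms in auto)

lemma N_2_lower_bound:
  assumes "3 ^ (k + 1) < p"
  shows "enat (k * 3 ^ (k - 1) div 2) \<le> N p 2 TYPE(2)"
proof -
  define P where "P = word_point k ` shallow k"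
  define \<B> where "\<B> = word_box k ` rect_index k"
  have shallow_words: "z \<in> words k \<times> words k" if "z \<in> shallow k" for z using that by (simp add: shallow_def)
  have mem: "word_point k z \<in> word_box k r \<longleftrightarrow> in_rect k z r" if "z \<in> shallow k" "r \<in> rect_index k" for z r
    using word_point_in_box_iff shallow_words that by blast
  have "\<not> (\<forall>\<H>. \<H> \<subseteq> \<G> \<and> card \<H> = 2 \<longrightarrow> \<Inter>\<H> = {})"
    if \<G>: "\<G> \<subseteq> trace_on \<B> P" "card \<G> = p" for \<G>
  proof
    assume disj: "\<forall>\<H>. \<H> \<subseteq> \<G> \<and> card \<H> = 2 \<longrightarrow> \<Inter>\<H> = {}"
    have "\<forall>F\<in>\<G>. \<exists>r. r \<in> rect_index k \<and> F = word_box k r \<inter> P"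
      using \<G>(1) unfolding trace_on_def \<B>_def by blast
    \<comment> \<open>One index per trace; distinct traces get distinct indices, so a disjoint
      \<open>\<G>\<close> would give a conflict-free set of \<open>p\<close> indices.\<close>
    then obtain r where r: "\<And>F. F \<in> \<G> \<Longrightarrow> r F \<in> rect_index k" "\<And>F. F \<in> \<G> \<Longrightarrow> F = word_box k (r F) \<inter> P"
      by metis
    have "inj_on r \<G>" using r(2) by (metis inj_onI)
    have "\<not> rect_conflict k (r F) (r F')" if F: "F \<in> \<G>" "F' \<in> \<G>" "r F \<noteq> r F'" for F F'
    proof
      assume "rect_conflict k (r F) (r F')"
      then obtain z where z: "z \<in> shallow k" "in_rect k z (r F)" "in_rect k z (r F')"
        unfolding rect_conflict_def by blast
      then have "word_point k z \<in> word_box k (r F) \<inter> P" "word_point k z \<in> word_box k (r F') \<inter> P"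
        using mem[OF z(1) r(1)] F by (auto simp: P_def)
      then have "word_point k z \<in> F" "word_point k z \<in> F'"
        unfolding r(2)[OF F(1), symmetric] r(2)[OF F(2), symmetric] .
      moreover have "card {F, F'} = 2" using F(3) by (metis card_2_iff)
      then have "\<Inter>{F, F'} = {}" using disj[rule_format, of "{F, F'}"] F(1,2) by blast
      ultimately show False by auto
    qed
    then have "card (r ` \<G>) \<le> 3 ^ (k + 1)"
      by (intro card_conflict_free_le) (use r(1) in blast)+
    then show False using \<G>(2) assms card_image[OF \<open>inj_on r \<G>\<close>] by simp
  qed
  then have "pq_property p 2 (trace_on \<B> P)" unfolding pq_property_def by blast
  moreover have "{} \<notin> trace_on \<B> P"
  proof
    assume "{} \<in> trace_on \<B> P"
    then obtain r where r: "r \<in> rect_index k" "word_box k r \<inter> P = {}" by (auto simp: trace_on_def \<B>_def)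
    then obtain z where "z \<in> shallow k" "in_rect k z r" using rect_meets_shallow by blast
    then show False using r mem[of z r] unfolding P_def by blast
  qed
  moreover have "enat (k * 3 ^ (k - 1) div 2) \<le> piercing_number (trace_on \<B> P)"
  proof (rule le_piercing_number)
    fix S assume S: "finite S" "\<forall>F\<in>trace_on \<B> P. S \<inter> F \<noteq> {}"
    have hit: "card {r \<in> rect_index k. s \<in> word_box k r} \<le> 2" if s: "s \<in> P" for s
    proof -
      obtain z where z: "z \<in> shallow k" "s = word_point k z" using s unfolding P_def by blast
      then have "{r \<in> rect_index k. s \<in> word_box k r} = {r \<in> rect_index k. in_rect k z r}"
        using mem[OF z(1)] unfolding z(2) by blast
      then show ?thesis using card_rects_at_shallow_point z(1) by simp
    qed
    \<comment> \<open>\<open>S\<close> may leave \<open>P\<close>, but every trace is hit inside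
      \<open>S \<inter> P\<close>.\<close>
    have "rect_index k \<subseteq> (\<Union>s\<in>S \<inter> P. {r \<in> rect_index k. s \<in> word_box k r})"
    proof
      fix r assume r: "r \<in> rect_index k"
      then have "word_box k r \<inter> P \<in> trace_on \<B> P" unfolding trace_on_def \<B>_def by blast
      then have "S \<inter> (word_box k r \<inter> P) \<noteq> {}" using S(2) by blast
      then show "r \<in> (\<Union>s\<in>S \<inter> P. {r \<in> rect_index k. s \<in> word_box k r})" using r by blast
    qed
    then have "card (rect_index k) \<le> card (\<Union>s\<in>S \<inter> P. {r \<in> rect_index k. s \<in> word_box k r})"
      using S(1) finite_rect_index by (intro card_mono) auto
    also have "\<dots> \<le> (\<Sum>s\<in>S \<inter> P. card {r \<in> rect_index k. s \<in> word_box k r})"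
      using S(1) by (intro card_UN_le) auto
    also have "\<dots> \<le> (\<Sum>s\<in>S \<inter> P. 2)" using hit by (intro sum_mono) auto
    also have "\<dots> \<le> 2 * card S" using S(1) by (simp add: card_mono)
    finally show "k * 3 ^ (k - 1) div 2 \<le> card S" by (simp add: card_rect_index)
  qed
  moreover have "finite \<B>" "\<forall>B\<in>\<B>. axis_parallel_box B"
    using finite_rect_index axis_parallel_word_box by (auto simp: \<B>_def)
  ultimately show ?thesis
    unfolding N_def by (intro Sup_upper2[where u = "piercing_number (trace_on \<B> P)"]) blast+
qed

text \<open>Choose \<open>k\<close> with \<open>3 ^ (k + 1) < p \<le> 3 ^ (k + 2)\<close>. Then
  \<open>p \<le> 27 * 3 ^ (k - 1)\<close> and \<open>ln p \<le> 4 * k\<close>, and rounding down the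
  half costs at most another factor 4, whence 432. The bound \<open>p > 27\<close> ensures
  \<open>k \<ge> 2\<close>.\<close>

lemma exists_level_count:
  fixes p :: nat
  assumes "p > 27"
  shows "\<exists>k. 3 ^ (k + 1) < p \<and> 1 / 432 * (real p * ln (real p)) \<le> real (k * 3 ^ (k - 1) div 2)"
proof -
  obtain m where m: "3 ^ m < p" "p \<le> 3 ^ (m + 1)"
    using ex_power_ivl2[of 3 p] assms by auto
  have "\<not> m + 1 \<le> 3"
  proof
    assume "m + 1 \<le> 3"
    then have "(3::nat) ^ (m + 1) \<le> 3 ^ 3" by (intro power_increasing) auto
    then show False using m assms by simp
  qed
  define k where "k = m - 1"
  have k: "k \<ge> 2" "m = k + 1" using \<open>\<not> m + 1 \<le> 3\<close> by (auto simp: k_def)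
  define q where "q = k * 3 ^ (k - 1)"
  have "3 ^ (k - 1) \<ge> (1::nat)" by simp
  then have "q \<ge> 2" using k(1) unfolding q_def by (metis mult_le_mono nat_mult_1_right)
  have p3: "p \<le> 27 * 3 ^ (k - 1)"
  proof -
    have "(3::nat) ^ (m + 1) = 27 * 3 ^ (k - 1)" using k by (cases k) auto
    then show ?thesis using m by simp
  qed
  have "ln (3::real) \<le> 2" using ln_le_minus_one[of "3::real"] by simp
  have "ln (real p) \<le> ln (real (3 ^ (m + 1)))" using m assms by (subst ln_le_cancel_iff) (auto simp: of_nat_le_iff simp del: of_nat_power)
  also have "\<dots> = real (k + 2) * ln 3" by (simp add: k ln_realpow del: power_Suc)
  also have "\<dots> \<le> real (2 * k) * 2" using k(1) \<open>ln 3 \<le> 2\<close> by (intro mult_mono) auto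
  finally have "ln (real p) \<le> 4 * real k" by simp
  moreover have "real p \<le> real (27 * 3 ^ (k - 1))" using p3 by (simp only: of_nat_le_iff)
  ultimately have "real p * ln (real p) \<le> real (27 * 3 ^ (k - 1)) * (4 * real k)"
    using assms by (intro mult_mono) auto
  also have "\<dots> = 108 * real q" by (simp add: q_def)
  also have "q \<le> 4 * (q div 2)" using \<open>q \<ge> 2\<close> by linarith
  then have "108 * real q \<le> 432 * real (q div 2)" by linarith
  finally have "1 / 432 * (real p * ln (real p)) \<le> real (q div 2)" by simp
  moreover have "3 ^ (k + 1) < p" using m k by simp
  ultimately show ?thesis unfolding q_def by blast
qed

section \<open>The bounds\<close>

text \<open>Staircases need a finite point set, so one common point is kept for each intersecting
  pair. The case \<open>B = B'\<close> keeps traces nonempty.\<close>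

lemma finite_trace_witnesses:
  fixes \<B> :: "'a set set"
  assumes "finite \<B>"
  shows "\<exists>P\<^sub>0\<subseteq>P. finite P\<^sub>0 \<and> (\<forall>B\<in>\<B>. \<forall>B'\<in>\<B>. B \<inter> B' \<inter> P \<noteq> {} \<longrightarrow> B \<inter> B' \<inter> P\<^sub>0 \<noteq> {})"
proof -
  let ?R = "{(B, B'). B \<in> \<B> \<and> B' \<in> \<B> \<and> B \<inter> B' \<inter> P \<noteq> {}}"
  define z where "z r = (SOME v. v \<in> fst r \<inter> snd r \<inter> P)" for r :: "'a set \<times> 'a set"
  have z: "z r \<in> fst r \<inter> snd r \<inter> P" if "r \<in> ?R" for r
    unfolding z_def some_in_eq using that by (simp add: case_prod_beta)
  have "finite ?R" by (rule finite_subset[of _ "\<B> \<times> \<B>"]) (use assms in auto)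
  show ?thesis
  proof (intro exI[of _ "z ` ?R"] conjI ballI impI)
    show "z ` ?R \<subseteq> P" using z by (meson Int_iff image_subsetI)
    show "finite (z ` ?R)" using \<open>finite ?R\<close> by (rule finite_imageI)
    fix B B' assume "B \<in> \<B>" "B' \<in> \<B>" "B \<inter> B' \<inter> P \<noteq> {}"
    then have "(B, B') \<in> ?R" by simp
    from z[OF this] imageI[OF this, of z] have "z (B, B') \<in> B \<inter> B' \<inter> z ` ?R" by simp
    then show "B \<inter> B' \<inter> z ` ?R \<noteq> {}" by blast
  qed
qed

text \<open>A larger packing contains \<open>p\<close> members disjoint on \<open>P\<close> as well.
  Their traces are nonempty, hence distinct, so the \<open>(p, 2)\<close>-property would make two of
  them meet.\<close>

lemma packing_le_of_pq_property:
  assumes pq: "pq_property p 2 (trace_on \<B> P)" and "{} \<notin> trace_on \<B> P"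
    and wit: "\<And>B B'. B \<in> \<B> \<Longrightarrow> B' \<in> \<B> \<Longrightarrow> B \<inter> B' \<inter> P \<noteq> {} \<Longrightarrow> B \<inter> B' \<inter> P\<^sub>0 \<noteq> {}"
  shows "packing_le P\<^sub>0 \<B> p"
  unfolding packing_le_def
proof (intro allI impI, rule ccontr)
  fix A assume A: "A \<subseteq> \<B>" "disjoint_family_on (\<lambda>B. B \<inter> P\<^sub>0) A" "\<not> card A \<le> p"
  then obtain A' where A': "A' \<subseteq> A" "card A' = p" "finite A'"
    by (metis linorder_not_le less_imp_le obtain_subset_with_card_n)
  have disj: "B \<inter> B' \<inter> P = {}" if "B \<in> A'" "B' \<in> A'" "B \<noteq> B'" for B B'
    using wit[of B B'] that A'(1) A(1,2) unfolding disjoint_family_on_def by blast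
  have nonempty: "B \<inter> P \<noteq> {}" if "B \<in> A'" for B
    using that A'(1) A(1) assms(2) unfolding trace_on_def by blast
  have "inj_on (\<lambda>B. B \<inter> P) A'"
  proof (rule inj_onI, rule ccontr)
    fix B B' assume "B \<in> A'" "B' \<in> A'" "B \<inter> P = B' \<inter> P" "B \<noteq> B'"
    then show False using disj[of B B'] nonempty[of B] by blast
  qed
  then have card: "card ((\<lambda>B. B \<inter> P) ` A') = p" using A'(2) card_image by blast
  have sub: "(\<lambda>B. B \<inter> P) ` A' \<subseteq> trace_on \<B> P"
    using A'(1) A(1) unfolding trace_on_def by blast
  obtain \<H> where \<H>: "\<H> \<subseteq> (\<lambda>B. B \<inter> P) ` A'" "card \<H> = 2" "\<Inter>\<H> \<noteq> {}"
    using pq[unfolded pq_property_def, rule_format, of "(\<lambda>B. B \<inter> P) ` A'"] sub card A'(3) by blast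
  obtain F F' where F: "\<H> = {F, F'}" "F \<noteq> F'" using \<H>(2) by (meson card_2_iff)
  have "F \<in> (\<lambda>B. B \<inter> P) ` A'" "F' \<in> (\<lambda>B. B \<inter> P) ` A'" using \<H>(1) F(1) by simp_all
  then obtain B B' where B: "B \<in> A'" "F = B \<inter> P" "B' \<in> A'" "F' = B' \<inter> P" by (elim imageE)
  then have "B \<noteq> B'" using F(2) by auto
  then have "B \<inter> B' \<inter> P = {}" using disj B(1,3) by simp
  moreover have "\<Inter>\<H> = B \<inter> B' \<inter> P" unfolding F(1) B(2,4) by auto
  ultimately show False using \<H>(3) by simp
qed

lemma N_2_upper_bound: "N p 2 TYPE(2) \<le> enat (2048 * p\<^sup>2)"
  unfolding N_def
proof (rule Sup_least, clarify)
  fix \<B> :: "(real ^ 2) set set" and P :: "(real ^ 2) set"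
  assume \<B>: "finite \<B>" "\<forall>B\<in>\<B>. axis_parallel_box B"
    and trace: "pq_property p 2 (trace_on \<B> P)" "{} \<notin> trace_on \<B> P"
  obtain P\<^sub>0 where P\<^sub>0: "P\<^sub>0 \<subseteq> P" "finite P\<^sub>0"
    "\<And>B B'. B \<in> \<B> \<Longrightarrow> B' \<in> \<B> \<Longrightarrow> B \<inter> B' \<inter> P \<noteq> {} \<Longrightarrow> B \<inter> B' \<inter> P\<^sub>0 \<noteq> {}"
    using finite_trace_witnesses[OF \<B>(1), of P] by metis
  have "axis_parallel_box B \<and> B \<inter> P\<^sub>0 \<noteq> {}" if "B \<in> \<B>" for B
  proof -
    have "B \<inter> P \<noteq> {}" using that trace(2) unfolding trace_on_def by blast
    then show ?thesis using P\<^sub>0(3)[of B B] \<B>(2) that by simp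
  qed
  then have "pierceable P\<^sub>0 \<B> (2048 * p\<^sup>2)"
    using P\<^sub>0(2) \<B>(1) packing_le_of_pq_property[OF trace P\<^sub>0(3)] by (intro pierceable_boxes)
  then obtain S where S: "S \<subseteq> P\<^sub>0" "finite S" "card S \<le> 2048 * p\<^sup>2" "\<forall>B\<in>\<B>. S \<inter> B \<noteq> {}"
    unfolding pierceable_def by blast
  have "\<forall>F\<in>trace_on \<B> P. S \<inter> F \<noteq> {}"
    using S(1,4) P\<^sub>0(1) unfolding trace_on_def by blast
  then have "piercing_number (trace_on \<B> P) \<le> enat (card S)"
    unfolding piercing_number_def using S(2) by (intro Inf_lower) blast
  also have "\<dots> \<le> enat (2048 * p\<^sup>2)" using S(3) by simp
  finally show "piercing_number (trace_on \<B> P) \<le> enat (2048 * p\<^sup>2)" .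
qed

theorem theorem1p5:
  shows "\<exists>(c::real) (C::real) (p\<^sub>0::nat). c > 0 \<and> C > 0 \<and>
    (\<forall>p::nat. p \<ge> p\<^sub>0 \<longrightarrow>
       ereal (c * (real p * ln (real p))) \<le> ereal_of_enat (N p 2 TYPE(2)) \<and>
       ereal_of_enat (N p 2 TYPE(2)) \<le> ereal (C * (real p * ln (ln (real p)))\<^sup>2))"
proof (rule exI[of _ "1 / 432"], rule exI[of _ 2048], rule exI[of _ "28 + nat \<lceil>exp (exp 1) :: real\<rceil>"],
    intro conjI allI impI)
  \<comment> \<open>The 28 serves \<open>exists_level_count\<close>; the other summand makes
    \<open>ln (ln p)\<close> at least 1, so that \<open>p\<^sup>2\<close> is below the claimed upper
    bound.\<close>
  fix p :: nat assume p: "28 + nat \<lceil>exp (exp 1) :: real\<rceil> \<le> p"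
  obtain k where k: "3 ^ (k + 1) < p" "1 / 432 * (real p * ln (real p)) \<le> real (k * 3 ^ (k - 1) div 2)"
    using exists_level_count[of p] p by auto
  have "ereal (1 / 432 * (real p * ln (real p))) \<le> ereal (real (k * 3 ^ (k - 1) div 2))"
    using k(2) by (simp only: ereal_less_eq)
  also have "\<dots> = ereal_of_enat (enat (k * 3 ^ (k - 1) div 2))" by simp
  also have "\<dots> \<le> ereal_of_enat (N p 2 TYPE(2))"
    using N_2_lower_bound[OF k(1)] by (simp only: ereal_of_enat_le_iff)
  finally show "ereal (1 / 432 * (real p * ln (real p))) \<le> ereal_of_enat (N p 2 TYPE(2))" .

  have "exp (exp 1) \<le> real p" using p by linarith
  then have "exp 1 \<le> ln (real p)" using p by (subst ln_ge_iff) auto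
  then have "1 \<le> ln (ln (real p))" by (subst ln_ge_iff) (auto intro: less_le_trans[OF exp_gt_zero])
  then have "real p * 1 \<le> real p * ln (ln (real p))" by (intro mult_left_mono) auto
  then have "(real p)\<^sup>2 \<le> (real p * ln (ln (real p)))\<^sup>2" by (intro power_mono) auto
  have "ereal_of_enat (N p 2 TYPE(2)) \<le> ereal_of_enat (enat (2048 * p\<^sup>2))"
    using N_2_upper_bound by (simp only: ereal_of_enat_le_iff)
  also have "\<dots> = ereal (2048 * (real p)\<^sup>2)" by simp
  also have "\<dots> \<le> ereal (2048 * (real p * ln (ln (real p)))\<^sup>2)"
    using \<open>(real p)\<^sup>2 \<le> (real p * ln (ln (real p)))\<^sup>2\<close> by simp
  finally show "ereal_of_enat (N p 2 TYPE(2)) \<le> ereal (2048 * (real p * ln (ln (real p)))\<^sup>2)" .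
qed auto

end
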